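(* Let $0<q<1$, $a>0$, and let $d$ be any real number with $q\le d<1$. Put $t_1=\sqrt{q^3/a}$, $t_2=\sqrt{q/a}$ and $$y^{(d)}_n:=\sqrt{aq}\,\bigl(d^{-1}q^{-2n}-d\,q^{2n}\bigr),\qquad n\in\mathbb Z .$$ Then for all integers $r,s\ge 0$ the polynomials $\tilde D_r^{(a)}(\,\cdot\,|q)$ satisfy the orthogonality relation $$\sum_{n=-\infty}^\infty \frac{(-t_1q^{-2n}/d,\ t_1q^{2n}d,\ -t_2q^{-2n}/d,\ t_2q^{2n}d;\,q^2)_\infty}{(-t_1t_2/q^2;q^2)_\infty}\; \frac{d^{4n}q^{2n(2n-1)}(1+d^2q^{4n})}{(-d^2;q^2)_\infty (-q^2/d^2;q^2)_\infty(q^2;q^2)_\infty}\; \tilde D_r^{(a)}(y^{(d)}_n|q)\,\tilde D_s^{(a)}(y^{(d)}_n|q) =\frac{(q^2;q^2)_r\,q^{-r}}{(-aq^2;q^2)_r}\,\delta_{rs}.$$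
   Context: Notation: $(b;q)_m=\prod_{j=0}^{m-1}(1-bq^j)$, $(b;q)_\infty=\prod_{j\ge 0}(1-bq^j)$, $(b_1,\dots,b_r;q)_m=\prod_i (b_i;q)_m$ (also for $m=\infty$). For $a>0$ the polynomials $\tilde D_n^{(a)}(y|q)$ (dual discrete $q$-ultraspherical polynomials with imaginary parameter) are defined by $$\tilde D_n^{(a)}(\mu(x)|q):={}_3\phi_2\left(q^{-x},\,-aq^{x+1},\,q^{-n};\ \mathrm i\sqrt a\,q,\,-\mathrm i\sqrt a\,q;\ q,\,-q^{n+1}\right)=\sum_{m=0}^n\frac{(q^{-x},-aq^{x+1},q^{-n};q)_m}{(\mathrm i\sqrt a\,q,-\mathrm i\sqrt a\,q,q;q)_m}(-q^{n+1})^m,\qquad \mu(x)=q^{-x}-aq^{x+1}.$$ Since $(q^{-x},-aq^{x+1};q)_m=\prod_{j=0}^{m-1}\bigl(1-aq^{2j+1}-q^j\mu(x)\bigr)$, $\tilde D_n^{(a)}(y|q)$ is a real polynomial of degree $n$ in $y=\mu(x)$. In particular, $$\tilde D_n^{(a)}(y^{(d)}_k|q)={}_3\phi_2\left(q^{-2k}d^{-1}\sqrt{aq},\,-q^{2k}d\sqrt{aq},\,q^{-n};\ \mathrm i\sqrt a\,q,\,-\mathrm i\sqrt a\,q;\ q,\,-q^{n+1}\right).$$ *)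

theory Defs
  imports "HOL-Analysis.Analysis"
begin

definition qpoch :: "'a::comm_ring_1 \<Rightarrow> 'a \<Rightarrow> nat \<Rightarrow> 'a" where
  "qpoch b q m = (\<Prod>j<m. 1 - b * q ^ j)"

definition qpoch_inf :: "'a::{t2_space, comm_ring_1} \<Rightarrow> 'a \<Rightarrow> 'a" where
  "qpoch_inf b q = (\<Prod>j. 1 - b * q ^ j)"

definition qpochs :: "'a::comm_ring_1 list \<Rightarrow> 'a \<Rightarrow> nat \<Rightarrow> 'a" where
  "qpochs bs q m = (\<Prod>b\<leftarrow>bs. qpoch b q m)"

definition qpochs_inf :: "'a::{t2_space, comm_ring_1} list \<Rightarrow> 'a \<Rightarrow> 'a" where
  "qpochs_inf bs q = (\<Prod>b\<leftarrow>bs. qpoch_inf b q)"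

definition phi32 ::
  "'a \<Rightarrow> 'a \<Rightarrow> 'a \<Rightarrow> 'a \<Rightarrow> 'a \<Rightarrow> 'a \<Rightarrow> 'a \<Rightarrow> 'a::real_normed_field" where
  "phi32 a1 a2 a3 b1 b2 q z =
     (\<Sum>m. qpochs [a1, a2, a3] q m / qpochs [b1, b2, q] q m * z ^ m)"

definition mu :: "real \<Rightarrow> real \<Rightarrow> real \<Rightarrow> real" where
  "mu a q x = q powr (- x) - a * q powr (x + 1)"

text \<open>The definite description below is well-defined for \<open>0 < q < 1\<close> and \<open>a > 0\<close>, see
  \<open>dual_ultra_ex1\<close>; an explicit formula for the polynomial is \<open>dual_ultra_explicit\<close>.\<close>

definition dual_ultra :: "real \<Rightarrow> real \<Rightarrow> nat \<Rightarrow> real poly" where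
  "dual_ultra a q n = (THE p. \<forall>x::real.
     complex_of_real (poly p (mu a q x)) =
       phi32 (of_real (q powr (- x))) (of_real (- a * q powr (x + 1))) (of_real (q powi (- int n)))
             (\<i> * of_real (sqrt a * q)) (- \<i> * of_real (sqrt a * q))
             (of_real q) (of_real (- (q ^ (n + 1)))))"

definition dual_ultra_sum :: "real \<Rightarrow> real \<Rightarrow> nat \<Rightarrow> real poly" where
  "dual_ultra_sum a q n = (\<Sum>m\<le>n.
     smult (qpoch (q powi (- int n)) q m / (qpoch (- a * q\<^sup>2) (q\<^sup>2) m * qpoch q q m)
            * (- (q ^ (n + 1))) ^ m)
       (\<Prod>j<m. [: 1 - a * q ^ (2 * j + 1), - (q ^ j) :]))"

lemma qpoch_of_real:
  "qpoch (of_real b) (of_real q) m = (of_real (qpoch b q m) :: 'a::{real_algebra_1, comm_ring_1})"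
  by (simp add: qpoch_def)

lemma qpoch_terminates:
  fixes q :: real
  assumes "q > 0" "n < m"
  shows "qpoch (q powi (- int n)) q m = 0"
  using assms by (auto simp: qpoch_def power_int_minus intro!: bexI[of _ n])

lemma qpoch_imag_pair:
  assumes "a > 0"
  shows "qpoch (\<i> * of_real (sqrt a * q)) (of_real q) m * qpoch (- \<i> * of_real (sqrt a * q)) (of_real q) m
           = complex_of_real (qpoch (- a * q\<^sup>2) (q\<^sup>2) m)"
proof -
  have a: "complex_of_real (sqrt a) * of_real (sqrt a) = of_real a"
    using assms by (metis less_eq_real_def of_real_mult real_sqrt_mult_self abs_of_pos)
  have "(1 - \<i> * of_real (sqrt a * q) * of_real q ^ j) * (1 - (- \<i> * of_real (sqrt a * q)) * of_real q ^ j)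
          = complex_of_real (1 - (- a * q\<^sup>2) * (q\<^sup>2) ^ j)" for j
  proof -
    have "(1 - \<i> * of_real (sqrt a * q) * of_real q ^ j) * (1 - (- \<i> * of_real (sqrt a * q)) * of_real q ^ j)
       = 1 + (complex_of_real (sqrt a) * of_real (sqrt a)) * (of_real q * of_real q) * (of_real q ^ j * of_real q ^ j)"
      by (simp add: algebra_simps)
    also have "\<dots> = complex_of_real (1 - (- a * q\<^sup>2) * (q\<^sup>2) ^ j)"
      unfolding a by (simp add: power2_eq_square power_mult_distrib)
    finally show ?thesis .
  qed
  then show ?thesis
    unfolding qpoch_def prod.distrib[symmetric] of_real_prod by simp
qed

lemma qpoch_mu_pair:
  fixes u :: real
  assumes "u \<noteq> 0"
  shows "qpoch u q m * qpoch (- (a * q / u)) q m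
           = (\<Prod>j<m. 1 - a * q ^ (2 * j + 1) - q ^ j * (u - a * q / u))"
proof -
  have "(1 - u * q ^ j) * (1 - (- (a * q / u)) * q ^ j)
          = 1 - a * q ^ (2 * j + 1) - q ^ j * (u - a * q / u)" for j
    using assms by (simp add: field_simps power_add power_mult power2_eq_square power_mult_distrib power_even_eq)
  then show ?thesis
    unfolding qpoch_def prod.distrib[symmetric] by simp
qed

lemma dual_ultra_sum_eq_phi32:
  fixes u :: real
  assumes "0 < q" "a > 0" "u \<noteq> 0"
  shows "complex_of_real (poly (dual_ultra_sum a q n) (u - a * q / u)) =
       phi32 (of_real u) (of_real (- (a * q / u))) (of_real (q powi (- int n)))
             (\<i> * of_real (sqrt a * q)) (- \<i> * of_real (sqrt a * q))
             (of_real q) (of_real (- (q ^ (n + 1))))"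
proof -
  let ?t = "\<lambda>m. (\<Prod>j<m. 1 - a * q ^ (2 * j + 1) - q ^ j * (u - a * q / u)) * qpoch (q powi (- int n)) q m
               / (qpoch (- a * q\<^sup>2) (q\<^sup>2) m * qpoch q q m) * (- (q ^ (n + 1))) ^ m"
  have t: "qpochs [of_real u, of_real (- (a * q / u)), of_real (q powi (- int n))] (of_real q) m
      / qpochs [\<i> * of_real (sqrt a * q), - \<i> * of_real (sqrt a * q), of_real q] (of_real q) m
      * of_real (- (q ^ (n + 1))) ^ m = complex_of_real (?t m)" for m
  proof -
    have 1: "qpochs [of_real u, of_real (- (a * q / u)), of_real (q powi (- int n))] (of_real q) m
       = complex_of_real ((qpoch u q m * qpoch (- (a * q / u)) q m) * qpoch (q powi (- int n)) q m)"
      unfolding qpochs_def list.map prod_list.Cons prod_list.Nil qpoch_of_real by simp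
    have 2: "qpochs [\<i> * of_real (sqrt a * q), - \<i> * of_real (sqrt a * q), of_real q] (of_real q) m
       = complex_of_real (qpoch (- a * q\<^sup>2) (q\<^sup>2) m * qpoch q q m)"
      unfolding qpochs_def list.map prod_list.Cons prod_list.Nil of_real_mult[of "qpoch _ _ _"]
        qpoch_imag_pair[OF assms(2), symmetric] qpoch_of_real mult_1_right mult.assoc ..
    show ?thesis
      unfolding 1 2 qpoch_mu_pair[OF assms(3)] by simp
  qed
  have "phi32 (of_real u) (of_real (- (a * q / u))) (of_real (q powi (- int n)))
             (\<i> * of_real (sqrt a * q)) (- \<i> * of_real (sqrt a * q))
             (of_real q) (of_real (- (q ^ (n + 1)))) = (\<Sum>m. complex_of_real (?t m))"
    unfolding phi32_def t ..
  also have "\<dots> = (\<Sum>m\<le>n. complex_of_real (?t m))"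
    by (rule suminf_finite) (use assms qpoch_terminates in auto)
  also have "\<dots> = complex_of_real (poly (dual_ultra_sum a q n) (u - a * q / u))"
    unfolding dual_ultra_sum_def poly_sum of_real_sum
    by (intro sum.cong refl) (simp add: poly_prod algebra_simps)
  finally show ?thesis ..
qed

lemma mu_eq:
  assumes "0 < q"
  shows "mu a q x = q powr (- x) - a * q / q powr (- x)"
    and "- a * q powr (x + 1) = - (a * q / q powr (- x))"
  using assms by (simp_all add: mu_def powr_add powr_minus field_simps)

lemma infinite_range_mu:
  assumes "0 < q" "q < 1" "a > 0"
  shows "infinite (range (mu a q))"
proof -
  have "mu a q x < mu a q y" if "x < y" for x y
  proof -
    have "q powr (- x) < q powr (- y)" "q powr (y + 1) < q powr (x + 1)"
      using assms that by (simp_all add: powr_less_mono')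
    moreover from this have "a * q powr (y + 1) < a * q powr (x + 1)"
      using assms by simp
    ultimately show ?thesis
      unfolding mu_def by linarith
  qed
  then have "inj (mu a q)"
    by (intro linorder_injI) (metis less_irrefl)
  then show ?thesis
    using infinite_UNIV_char_0 by (metis finite_imageD)
qed

lemma dual_ultra_ex1:
  assumes "0 < q" "q < 1" "a > 0"
  shows "\<exists>!p. \<forall>x::real. complex_of_real (poly p (mu a q x)) =
       phi32 (of_real (q powr (- x))) (of_real (- a * q powr (x + 1))) (of_real (q powi (- int n)))
             (\<i> * of_real (sqrt a * q)) (- \<i> * of_real (sqrt a * q))
             (of_real q) (of_real (- (q ^ (n + 1))))" (is "\<exists>!p. \<forall>x. ?L p x = ?R x")
proof (rule ex1I[of _ "dual_ultra_sum a q n"])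
  have R: "?L (dual_ultra_sum a q n) x = ?R x" for x
    unfolding mu_eq[OF assms(1)] using assms by (intro dual_ultra_sum_eq_phi32) auto
  then show "\<forall>x. ?L (dual_ultra_sum a q n) x = ?R x" by blast
  fix p assume p: "\<forall>x. ?L p x = ?R x"
  have "poly p (mu a q x) = poly (dual_ultra_sum a q n) (mu a q x)" for x
    using p R by (metis of_real_eq_iff)
  then have "range (mu a q) \<subseteq> {y. poly (p - dual_ultra_sum a q n) y = 0}"
    by auto
  then have "infinite {y. poly (p - dual_ultra_sum a q n) y = 0}"
    using infinite_range_mu[OF assms] infinite_super by blast
  then have "p - dual_ultra_sum a q n = 0"
    using poly_roots_finite by blast
  then show "p = dual_ultra_sum a q n" by simp
qed

lemma dual_ultra_explicit:
  assumes "0 < q" "q < 1" "a > 0"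
  shows "dual_ultra a q n = dual_ultra_sum a q n"
  unfolding dual_ultra_def
proof (rule the1_equality[OF dual_ultra_ex1[OF assms]], intro allI)
  fix x :: real
  show "complex_of_real (poly (dual_ultra_sum a q n) (mu a q x)) =
       phi32 (of_real (q powr (- x))) (of_real (- a * q powr (x + 1))) (of_real (q powi (- int n)))
             (\<i> * of_real (sqrt a * q)) (- \<i> * of_real (sqrt a * q))
             (of_real q) (of_real (- (q ^ (n + 1))))"
    unfolding mu_eq[OF assms(1)] using assms by (intro dual_ultra_sum_eq_phi32) auto
qed

end

theory Submission
  imports Defs
begin

text \<open>
  Write \<open>e\<^sub>n = q^(-2n)/d\<close> and \<open>W\<^sub>n(t) = (-t e\<^sub>n, t/e\<^sub>n; q)\<^sub>\<infinity>\<close>. Since \<open>t\<^sub>1 = q t\<^sub>2\<close>, the four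
  base \<open>q\<^sup>2\<close> products of the weight combine to \<open>W\<^sub>n(t\<^sub>2)\<close>, and multiplying \<open>W\<^sub>n(t\<^sub>2)\<close> by the \<open>m\<close>-th
  basis polynomial \<open>\<Prod>j<m. 1 - a q^(2j+1) - q^j y\<close> at \<open>y = y\<^sub>n\<close> gives a multiple of \<open>W\<^sub>n(t\<^sub>2 q^(-m))\<close>.
  So all moments follow from the total mass \<open>G(t)\<close> with a free parameter \<open>t\<close>. A telescoping identity
  yields \<open>G(t) = (1 + t\<^sup>2/q) G(q t)\<close>, hence \<open>G(t) = (-t\<^sup>2/q; q\<^sup>2)\<^sub>\<infinity> G(0)\<close>, and \<open>G(0)\<close> is a theta series,
  evaluated by the Jacobi triple product. The moments give the case \<open>s = 0\<close>; the three-term recurrence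
  then propagates orthogonality to all \<open>r\<close>, \<open>s\<close>.
\<close>

subsection \<open>Infinite q-Pochhammer symbols\<close>

lemma qpoch_Suc: "qpoch b q (Suc n) = qpoch b q n * (1 - b * q ^ n)"
  by (simp add: qpoch_def)

lemma qpoch_0 [simp]: "qpoch b q 0 = 1"
  by (simp add: qpoch_def)

lemma qpoch_Suc_shift: "qpoch b q (Suc n) = (1 - b) * qpoch (b * q) q n"
  unfolding qpoch_def prod.lessThan_Suc_shift by (simp add: mult.assoc)

lemma qpoch_double: "qpoch b q (2 * n) = qpoch b (q\<^sup>2) n * qpoch (b * q) (q\<^sup>2) n"
  by (induction n) (simp_all add: qpoch_Suc mult_ac flip: power_mult)

context
  fixes q :: real
  assumes q: "0 < q" "q < 1"
begin

lemma qpoch_LIMSEQ: "(\<lambda>n. qpoch b q n) \<longlonglongrightarrow> qpoch_inf b q"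
proof -
  have "summable (\<lambda>j. norm (b * q ^ j))"
    using q by (simp add: abs_mult summable_mult)
  then have "abs_convergent_prod (\<lambda>j. 1 - b * q ^ j)"
    by (simp add: abs_convergent_prod_conv_summable)
  then have "(\<lambda>n. \<Prod>j\<le>n. 1 - b * q ^ j) \<longlonglongrightarrow> qpoch_inf b q"
    unfolding qpoch_inf_def
    by (intro convergent_prod_LIMSEQ abs_convergent_prod_imp_convergent_prod)
  then show ?thesis
    unfolding qpoch_def using LIMSEQ_lessThan_iff_atMost[of "prod (\<lambda>j. 1 - b * q ^ j)"] by blast
qed

lemma qpoch_inf_rec: "qpoch_inf b q = (1 - b) * qpoch_inf (b * q) q"
proof (rule LIMSEQ_unique)
  show "(\<lambda>n. qpoch b q (Suc n)) \<longlonglongrightarrow> qpoch_inf b q"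
    by (rule LIMSEQ_Suc[OF qpoch_LIMSEQ])
  show "(\<lambda>n. qpoch b q (Suc n)) \<longlonglongrightarrow> (1 - b) * qpoch_inf (b * q) q"
    unfolding qpoch_Suc_shift by (intro tendsto_intros qpoch_LIMSEQ)
qed

lemma qpoch_inf_0 [simp]: "qpoch_inf 0 q = 1"
  by (simp add: qpoch_inf_def)

lemma qpoch_inf_shift: "qpoch_inf b q = qpoch b q n * qpoch_inf (b * q ^ n) q"
proof (induction n)
  case (Suc n)
  then show ?case
    by (simp add: qpoch_Suc qpoch_inf_rec[of "b * q ^ n"] mult_ac)
qed simp

text \<open>The triangle inequality bounds each factor by \<open>1 + c * q ^ j\<close>. Such
  products with nonpositive parameter dominate the mass series below.\<close>

lemma abs_qpoch_inf_le:
  assumes "\<bar>b\<bar> \<le> c"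
  shows "\<bar>qpoch_inf b q\<bar> \<le> qpoch_inf (- c) q"
proof (rule LIMSEQ_le)
  show "(\<lambda>n. \<bar>qpoch b q n\<bar>) \<longlonglongrightarrow> \<bar>qpoch_inf b q\<bar>"
    by (intro tendsto_intros qpoch_LIMSEQ)
  show "(\<lambda>n. qpoch (- c) q n) \<longlonglongrightarrow> qpoch_inf (- c) q"
    by (rule qpoch_LIMSEQ)
  have "\<bar>1 - b * q ^ j\<bar> \<le> 1 - (- c) * q ^ j" for j
  proof -
    have "\<bar>1 - b * q ^ j\<bar> \<le> 1 + \<bar>b\<bar> * q ^ j"
      using abs_triangle_ineq4[of 1 "b * q ^ j"] q by (simp add: abs_mult)
    also have "\<dots> \<le> 1 + c * q ^ j"
      using assms q by (intro add_mono mult_right_mono) auto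
    finally show ?thesis by simp
  qed
  then show "\<exists>N. \<forall>n\<ge>N. \<bar>qpoch b q n\<bar> \<le> qpoch (- c) q n"
    unfolding qpoch_def abs_prod by (intro exI[of _ 0] allI impI prod_mono) auto
qed

lemma qpoch_inf_ge_1:
  assumes "b \<le> 0"
  shows "qpoch_inf b q \<ge> 1"
proof (rule LIMSEQ_le_const[OF qpoch_LIMSEQ])
  have "1 \<le> 1 - b * q ^ j" for j
    using assms q by (simp add: mult_nonpos_nonneg)
  then show "\<exists>N. \<forall>n\<ge>N. 1 \<le> qpoch b q n"
    unfolding qpoch_def by (intro exI[of _ 0] allI impI prod_ge_1) auto
qed

lemma qpoch_inf_unit_interval:
  assumes "0 \<le> b" "b \<le> 1"
  shows "0 \<le> qpoch_inf b q" "qpoch_inf b q \<le> 1"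
proof -
  have "0 \<le> 1 - b * q ^ j" "1 - b * q ^ j \<le> 1" for j
    using assms q mult_mono[of b 1 "q ^ j" 1] by (auto simp: power_le_one)
  then have *: "0 \<le> qpoch b q n" "qpoch b q n \<le> 1" for n
    unfolding qpoch_def by (auto intro!: prod_nonneg prod_le_1)
  show "0 \<le> qpoch_inf b q"
    by (rule LIMSEQ_le_const[OF qpoch_LIMSEQ]) (use * in auto)
  show "qpoch_inf b q \<le> 1"
    by (rule LIMSEQ_le_const2[OF qpoch_LIMSEQ]) (use * in auto)
qed

text \<open>For \<open>0 <= b < 1\<close> no factor vanishes, and a convergent product of nonzero
  factors is nonzero; for negative \<open>b\<close> the product is at least 1.\<close>

lemma qpoch_inf_pos:
  assumes "b < 1"
  shows "qpoch_inf b q > 0"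
proof -
  have "qpoch_inf b q \<noteq> 0" if "0 \<le> b"
  proof -
    have "norm (b * q ^ j) \<noteq> 1" for j
      using assms that q mult_mono[of b b "q ^ j" 1] by (auto simp: power_le_one abs_mult)
    then have "1 - b * q ^ j \<noteq> 0" for j
      by (metis eq_iff_diff_eq_0 norm_one)
    moreover have "summable (\<lambda>j. norm (b * q ^ j))"
      using q by (simp add: abs_mult summable_mult)
    then have "convergent_prod (\<lambda>j. 1 - b * q ^ j)"
      by (intro abs_convergent_prod_imp_convergent_prod) (simp add: abs_convergent_prod_conv_summable)
    ultimately show ?thesis
      unfolding qpoch_inf_def using prodinf_nonzero by blast
  qed
  then show ?thesis
    using qpoch_inf_unit_interval(1)[of b] qpoch_inf_ge_1[of b] assms
    by (cases "0 \<le> b") (auto simp: less_le)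
qed

text \<open>For the parameter \<open>-|b|\<close> the tail is the full product over a partial
  product, so it tends to 1. The general tail is no further from 1, since
  \<open>|prod (1 + x_j) - 1| <= prod (1 + |x_j|) - 1\<close>.\<close>

lemma qpoch_inf_tendsto_1: "(\<lambda>N. qpoch_inf (b * q ^ N) q) \<longlonglongrightarrow> 1"
proof -
  let ?c = "- \<bar>b\<bar>"
  have pos: "qpoch_inf ?c q \<noteq> 0"
    using qpoch_inf_ge_1[of ?c] by simp
  have pos': "qpoch ?c q N \<noteq> 0" for N
    using pos qpoch_inf_shift[of ?c N] by auto
  have eq: "qpoch_inf (?c * q ^ N) q = qpoch_inf ?c q / qpoch ?c q N" for N
    using qpoch_inf_shift[of ?c N] pos'[of N] by (simp add: field_simps)
  have "(\<lambda>N. qpoch_inf ?c q / qpoch ?c q N) \<longlonglongrightarrow> qpoch_inf ?c q / qpoch_inf ?c q"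
    by (intro tendsto_intros qpoch_LIMSEQ pos)
  then have "(\<lambda>N. qpoch_inf (?c * q ^ N) q) \<longlonglongrightarrow> 1"
    unfolding eq using pos by simp
  then have lim: "(\<lambda>N. qpoch_inf (?c * q ^ N) q - 1) \<longlonglongrightarrow> 0"
    by (rule LIM_zero)
  have bound: "\<bar>qpoch_inf x q - 1\<bar> \<le> qpoch_inf (- \<bar>x\<bar>) q - 1" for x
  proof (rule LIMSEQ_le)
    show "(\<lambda>n. \<bar>qpoch x q n - 1\<bar>) \<longlonglongrightarrow> \<bar>qpoch_inf x q - 1\<bar>"
      by (intro tendsto_intros qpoch_LIMSEQ)
    show "(\<lambda>n. qpoch (- \<bar>x\<bar>) q n - 1) \<longlonglongrightarrow> qpoch_inf (- \<bar>x\<bar>) q - 1"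
      by (intro tendsto_intros qpoch_LIMSEQ)
    have "\<bar>qpoch x q n - 1\<bar> \<le> qpoch (- \<bar>x\<bar>) q n - 1" for n
      using norm_prod_minus1_le_prod_minus1[of "\<lambda>j. - (x * q ^ j)" "{..<n}"] q
      unfolding qpoch_def by (simp add: abs_mult)
    then show "\<exists>N. \<forall>n\<ge>N. \<bar>qpoch x q n - 1\<bar> \<le> qpoch (- \<bar>x\<bar>) q n - 1"
      by blast
  qed
  have "norm (qpoch_inf (b * q ^ N) q - 1) \<le> qpoch_inf (?c * q ^ N) q - 1" for N
    using bound[of "b * q ^ N"] q by (simp add: abs_mult)
  then have "(\<lambda>N. qpoch_inf (b * q ^ N) q - 1) \<longlonglongrightarrow> 0"
    by (intro Lim_null_comparison[OF _ lim] always_eventually allI)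
  then show ?thesis
    by (rule LIM_zero_cancel)
qed

end

lemma qpoch_inf_base_square:
  fixes q :: real
  assumes "0 < q" "q < 1"
  shows "qpoch_inf b q = qpoch_inf b (q\<^sup>2) * qpoch_inf (b * q) (q\<^sup>2)"
proof (rule LIMSEQ_unique)
  show "(\<lambda>n. qpoch b q (2 * n)) \<longlonglongrightarrow> qpoch_inf b q"
    using LIMSEQ_subseq_LIMSEQ[OF qpoch_LIMSEQ[OF assms], of "\<lambda>n. 2 * n" b]
    by (simp add: strict_mono_def o_def)
  show "(\<lambda>n. qpoch b q (2 * n)) \<longlonglongrightarrow> qpoch_inf b (q\<^sup>2) * qpoch_inf (b * q) (q\<^sup>2)"
    unfolding qpoch_double using assms
    by (intro tendsto_mult qpoch_LIMSEQ) (simp_all add: power_less_one_iff)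
qed

subsection \<open>Sums over the integers\<close>

text \<open>Lebesgue's theorem for the counting measure, carried over via
  \<open>infsetsum\<close>.\<close>

lemma infsum_dominated_convergence:
  fixes f :: "nat \<Rightarrow> 'i \<Rightarrow> real"
  assumes lim: "\<And>i. (\<lambda>N. f N i) \<longlonglongrightarrow> g i"
    and bound: "\<And>N i. \<bar>f N i\<bar> \<le> h i"
    and h: "h summable_on UNIV"
  shows "(\<lambda>N. infsum (f N) UNIV) \<longlonglongrightarrow> infsum g UNIV"
proof -
  have sm: "Infinite_Set_Sum.abs_summable_on F UNIV" if "\<And>i. \<bar>F i\<bar> \<le> h i" for F
    using Infinite_Sum.abs_summable_on_comparison_test'[OF h, of F] that
    by (simp add: abs_summable_equivalent[symmetric])
  have g: "\<bar>g i\<bar> \<le> h i" for i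
    by (rule LIMSEQ_le_const2[OF tendsto_rabs[OF lim]]) (use bound in auto)
  have "Infinite_Set_Sum.abs_summable_on h UNIV"
    using order_trans[OF abs_ge_zero bound] by (intro sm) (simp add: abs_of_nonneg)
  then have "(\<lambda>N. integral\<^sup>L (count_space UNIV) (f N)) \<longlonglongrightarrow> integral\<^sup>L (count_space UNIV) g"
    by (intro integral_dominated_convergence[where w = h])
       (auto simp: abs_summable_on_def lim bound)
  then show ?thesis
    using infsetsum_infsum[OF sm[OF g]] infsetsum_infsum[OF sm[OF bound]]
    by (simp add: infsetsum_def)
qed

lemma summable_ratio_to_zero:
  fixes f \<rho> :: "nat \<Rightarrow> real"
  assumes "\<And>n. 0 \<le> f n" "\<And>n. f (Suc n) \<le> \<rho> n * f n" "\<rho> \<longlonglongrightarrow> 0"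
  shows "summable f"
proof -
  obtain N where N: "\<And>n. n \<ge> N \<Longrightarrow> \<rho> n < 1 / 2"
    using order_tendstoD(2)[OF assms(3), of "1 / 2"] by (auto simp: eventually_sequentially)
  show ?thesis
  proof (rule summable_ratio_test[of "1 / 2" N])
    fix n assume "n \<ge> N"
    then have "\<rho> n * f n \<le> 1 / 2 * f n"
      using N[of n] assms(1) by (intro mult_right_mono) auto
    then show "norm (f (Suc n)) \<le> 1 / 2 * norm (f n)"
      using assms(1)[of n] assms(1)[of "Suc n"] assms(2)[of n] by simp
  qed simp
qed

lemma summable_on_int:
  fixes f :: "int \<Rightarrow> real"
  assumes "\<And>n. 0 \<le> f n" "summable (\<lambda>n. f (int n))" "summable (\<lambda>n. f (- int n))"
  shows "f summable_on UNIV"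
proof -
  have "f summable_on range int" "f summable_on range (\<lambda>n. - int n)"
    using assms by (simp_all add: summable_on_reindex inj_on_def o_def summable_on_UNIV_nonneg_real_iff)
  moreover have "x \<in> range int \<union> range (\<lambda>n. - int n)" for x
    by (cases x rule: int_cases2) auto
  then have "range int \<union> range (\<lambda>n. - int n) = UNIV"
    by blast
  ultimately show ?thesis
    using summable_on_union[of f "range int" "range (\<lambda>n. - int n)"] by simp
qed

lemma infsum_shift_int:
  fixes f :: "int \<Rightarrow> real"
  shows "infsum (\<lambda>n. f (n + k)) UNIV = infsum f UNIV"
  by (rule infsum_reindex_bij_witness[of _ "\<lambda>n. n - k" "\<lambda>n. n + k"]) auto

subsection \<open>The Jacobi triple product\<close>

text \<open>The general term of a theta series in base \<open>Q = q^2\<close>: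
  \<open>Q^(k(k-1)/2)\<close> becomes \<open>q^(k(k-1))\<close> and needs no halving.\<close>

definition theta_term :: "real \<Rightarrow> real \<Rightarrow> int \<Rightarrow> real" where
  "theta_term q z k = z powi k * q powi (k * (k - 1))"

context
  fixes q :: real
  assumes q: "0 < q" "q < 1"
begin

lemma theta_term_nonneg: "z > 0 \<Longrightarrow> theta_term q z k \<ge> 0"
  using q by (simp add: theta_term_def)

lemma theta_term_step:
  assumes "z > 0"
  shows "theta_term q z (k + 1) = z * q\<^sup>2 powi k * theta_term q z k"
proof -
  have "(k + 1) * (k + 1 - 1) = 2 * k + k * (k - 1)"
    by (simp add: algebra_simps)
  moreover have "q\<^sup>2 powi k = q powi (2 * k)"
    by (simp add: power_int_mult)
  ultimately show ?thesis
    using assms q unfolding theta_term_def by (simp only: power_int_add) (simp add: power_int_add)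
qed

lemma theta_term_summable:
  assumes "z > 0"
  shows "theta_term q z summable_on UNIV"
proof (rule summable_on_int)
  have summable: "summable (\<lambda>n. theta_term q u (int n))" if "u > 0" for u
  proof (rule summable_ratio_to_zero)
    show "0 \<le> theta_term q u (int n)" for n
      using that by (rule theta_term_nonneg)
    show "theta_term q u (int (Suc n)) \<le> u * (q\<^sup>2) ^ n * theta_term q u (int n)" for n
      using theta_term_step[OF that, of "int n"] by (simp add: add.commute)
    have "(\<lambda>n. u * (q\<^sup>2) ^ n) \<longlonglongrightarrow> u * 0"
      using q by (intro tendsto_intros LIMSEQ_power_zero) (simp add: power_less_one_iff)
    then show "(\<lambda>n. u * (q\<^sup>2) ^ n) \<longlonglongrightarrow> 0"
      by simp
  qed
  show "summable (\<lambda>n. theta_term q z (int n))"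
    using assms by (rule summable)
  \<comment> \<open>Reflection \<open>k -> -k\<close> replaces \<open>z\<close> by
    \<open>q^2 / z\<close>, so the negative half is an instance of the positive one.\<close>
  have "theta_term q z (- int n) = theta_term q (q\<^sup>2 / z) (int n)" for n
  proof -
    have "- int n * (- int n - 1) = 2 * int n + int n * (int n - 1)"
      by (simp add: algebra_simps)
    moreover have "q powi (2 * int n) = (q\<^sup>2) ^ n"
      by (simp add: power_int_mult)
    ultimately have "q powi (- int n * (- int n - 1)) = (q\<^sup>2) ^ n * q powi (int n * (int n - 1))"
      using q by (metis power_int_add less_irrefl)
    then show ?thesis
      using assms unfolding theta_term_def by (simp add: power_int_minus power_mult_distrib power_inverse divide_inverse mult_ac)
  qed
  then show "summable (\<lambda>n. theta_term q z (- int n))"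
    using summable[of "q\<^sup>2 / z"] assms q by simp
qed (use assms in \<open>simp add: theta_term_nonneg\<close>)

text \<open>The factor of index \<open>-j\<close> is zero. This is what cuts the bilateral series at
  \<open>N = 1\<close> down to a unilateral one.\<close>

lemma qpoch_inf_powi_nonpos:
  assumes "j \<le> 0"
  shows "qpoch_inf (q powi j) q = 0"
proof -
  have "q powi j * q ^ nat (- j) = 1"
    using assms q by (auto simp: power_int_def simp flip: power_mult_distrib)
  then show ?thesis
    using qpoch_inf_shift[OF q, of "q powi j" "nat (- j)"] qpoch_inf_rec[OF q, of 1] by simp
qed

lemma abs_qpoch_inf_powi_le_1: "\<bar>qpoch_inf (q powi j) q\<bar> \<le> 1"
proof (cases "j \<le> 0")
  case False
  then have "0 \<le> q powi j" "q powi j \<le> 1"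
    using q by (auto simp: power_int_def power_le_one)
  then show ?thesis
    using qpoch_inf_unit_interval[OF q, of "q powi j"] by simp
qed (simp add: qpoch_inf_powi_nonpos)

end

context
  fixes q :: real
  assumes q: "0 < q" "q < 1"
begin

lemma base_square: "0 < q\<^sup>2" "q\<^sup>2 < 1"
  using q by (simp_all add: power_less_one_iff)

text \<open>The series \<open>\<Sum>k. (b Q^k; Q)\<^sub>\<infinity> z^k Q^(k(k-1)/2)\<close> with \<open>Q = q\<^sup>2\<close> and \<open>b = Q^N\<close> interpolates
  between Euler's unilateral series (\<open>N = 1\<close>, as \<open>(Q^j; Q)\<^sub>\<infinity> = 0\<close> for \<open>j \<le> 0\<close>) and the theta
  series (\<open>N \<rightarrow> \<infinity>\<close>).\<close>

definition theta_interp :: "nat \<Rightarrow> real \<Rightarrow> int \<Rightarrow> real" where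
  "theta_interp N z k = qpoch_inf (q\<^sup>2 powi (k + int N)) (q\<^sup>2) * theta_term q z k"

section \<open>Functional equations of the interpolating series\<close>

lemma abs_theta_interp_le:
  assumes "z > 0"
  shows "\<bar>theta_interp N z k\<bar> \<le> theta_term q z k"
  using mult_right_mono[OF abs_qpoch_inf_powi_le_1[OF base_square, of "k + int N"]
      theta_term_nonneg[OF q assms, of k]] theta_term_nonneg[OF q assms, of k]
  by (simp add: theta_interp_def abs_mult)

lemma theta_interp_summable:
  assumes "z > 0"
  shows "theta_interp N z summable_on UNIV"
proof -
  have "(\<lambda>k. norm (theta_interp N z k)) summable_on UNIV"
    by (rule Infinite_Sum.abs_summable_on_comparison_test'[OF theta_term_summable[OF q assms]])
       (simp add: abs_theta_interp_le[OF assms])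
  then show ?thesis
    by (rule abs_summable_summable)
qed

text \<open>Splits off the first factor \<open>1 - Q^(k+N)\<close>, with \<open>Q = q^2\<close>. The
  subtracted term can be read as a shift \<open>k -> k + 1\<close> at fixed \<open>N\<close>, or for
  \<open>N = 0\<close> as the term with \<open>z * Q\<close> in place of \<open>z\<close>; the two
  functional equations below are built on these readings.\<close>

lemma theta_interp_rec:
  assumes "z > 0"
  shows "theta_interp N z k = theta_interp (Suc N) z k
    - qpoch_inf (q\<^sup>2 powi (k + 1 + int N)) (q\<^sup>2) * (q\<^sup>2) ^ N * q\<^sup>2 powi k * theta_term q z k"
proof -
  have "qpoch_inf (q\<^sup>2 powi (k + int N)) (q\<^sup>2)
      = (1 - q\<^sup>2 powi k * (q\<^sup>2) ^ N) * qpoch_inf (q\<^sup>2 powi (k + 1 + int N)) (q\<^sup>2)"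
    using q by (subst qpoch_inf_rec[OF base_square]) (simp add: power_int_add mult_ac)
  moreover have "k + int (Suc N) = k + 1 + int N"
    by simp
  ultimately show ?thesis
    unfolding theta_interp_def by (simp only:) (simp add: algebra_simps)
qed

lemma infsum_theta_interp_Suc:
  assumes "z > 0"
  shows "infsum (theta_interp (Suc N) z) UNIV = (1 + (q\<^sup>2) ^ N / z) * infsum (theta_interp N z) UNIV"
proof -
  note sm = theta_interp_summable[OF assms]
  define c where "c = (q\<^sup>2) ^ N / z"
  have "theta_interp (Suc N) z k = theta_interp N z k + c * theta_interp N z (k + 1)" for k
    using theta_interp_rec[OF assms, of N k] theta_term_step[OF q assms, of k] assms
    by (simp add: theta_interp_def c_def)
  then have "infsum (theta_interp (Suc N) z) UNIV
      = (\<Sum>\<^sub>\<infinity>k. theta_interp N z k + c * theta_interp N z (k + 1))"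
    by (rule infsum_cong)
  moreover have "(\<lambda>k. theta_interp N z (k + 1)) summable_on UNIV"
    by (subst summable_on_reindex_bij_witness[of _ "\<lambda>n. n - 1" "\<lambda>n. n + 1" UNIV]) (auto simp: sm)
  ultimately show ?thesis
    unfolding c_def[symmetric] by (simp add: infsum_add infsum_cmult_right sm summable_on_cmult_right infsum_shift_int algebra_simps)
qed

text \<open>Let \<open>S_N\<close> be the sum of \<open>theta_interp N\<close>. The split gives
  \<open>S_0(z) = S_1(z) - S_1(z Q)\<close>, an index shift gives
  \<open>S_0(z) = z S_1(z Q)\<close>, and \<open>S_0\<close> is eliminated.\<close>

lemma infsum_theta_interp_1_step:
  assumes "z > 0"
  shows "infsum (theta_interp 1 z) UNIV = (1 + z) * infsum (theta_interp 1 (z * q\<^sup>2)) UNIV"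
proof -
  have z': "z * q\<^sup>2 > 0"
    using assms q by simp
  note sm = theta_interp_summable[OF assms] theta_interp_summable[OF z']
  have th: "theta_term q (z * q\<^sup>2) k = q\<^sup>2 powi k * theta_term q z k" for k
    by (simp add: theta_term_def power_int_mult_distrib)
  have "theta_interp 1 z k = theta_interp 0 z k + theta_interp 1 (z * q\<^sup>2) k" for k
    using theta_interp_rec[OF assms, of 0 k] by (simp add: theta_interp_def th)
  then have "infsum (theta_interp 1 z) UNIV
      = infsum (theta_interp 0 z) UNIV + infsum (theta_interp 1 (z * q\<^sup>2)) UNIV"
    using infsum_add[OF sm(1)[of 0] sm(2)[of 1]] infsum_cong[of UNIV "theta_interp 1 z"] by metis
  moreover have "theta_interp 0 z (k + 1) = z * theta_interp 1 (z * q\<^sup>2) k" for k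
    using theta_term_step[OF q assms, of k] by (simp add: theta_interp_def th)
  then have "infsum (theta_interp 0 z) UNIV = z * infsum (theta_interp 1 (z * q\<^sup>2)) UNIV"
    using infsum_shift_int[of "theta_interp 0 z" 1] by (simp add: infsum_cmult_right')
  ultimately show ?thesis
    by (simp add: algebra_simps)
qed

text \<open>Iteration drives \<open>z\<close> to 0, where only the term \<open>k = 0\<close>
  survives. Up to the factor \<open>(Q; Q)_inf\<close> this is Euler's series for
  \<open>(-z; Q)_inf\<close>.\<close>

lemma infsum_theta_interp_1:
  assumes "z > 0"
  shows "infsum (theta_interp 1 z) UNIV = qpoch_inf (- z) (q\<^sup>2) * qpoch_inf (q\<^sup>2) (q\<^sup>2)"
proof -
  let ?S = "\<lambda>z. infsum (theta_interp 1 z) UNIV"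
  have pos: "z * (q\<^sup>2) ^ N > 0" for N
    using assms q by simp
  have iter: "?S z = qpoch (- z) (q\<^sup>2) N * ?S (z * (q\<^sup>2) ^ N)" for N
  proof (induction N)
    case (Suc N)
    then show ?case
      using infsum_theta_interp_1_step[OF pos, of N] by (simp add: qpoch_Suc mult_ac)
  qed simp
  let ?g = "\<lambda>k::int. if k = 0 then qpoch_inf (q\<^sup>2) (q\<^sup>2) else 0"
  have "(\<lambda>N. ?S (z * (q\<^sup>2) ^ N)) \<longlonglongrightarrow> infsum ?g UNIV"
  proof (rule infsum_dominated_convergence[OF _ _ theta_term_summable[OF q assms]])
    have neg: "theta_interp 1 (z * (q\<^sup>2) ^ N) k = 0" if "k < 0" for k N
      using that qpoch_inf_powi_nonpos[OF base_square, of "k + 1"] by (simp add: theta_interp_def)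
    \<comment> \<open>For \<open>k >= 0\<close> the rescaling only shrinks the term, so the theta
      series at the original \<open>z\<close> dominates for all \<open>N\<close>; for
      \<open>k < 0\<close> it would enlarge \<open>z powi k\<close>, but there the term is
      zero.\<close>
    have nonneg: "theta_interp 1 (z * (q\<^sup>2) ^ N) k = ((q\<^sup>2) ^ nat k) ^ N * theta_interp 1 z k"
      if "k \<ge> 0" for k N
    proof -
      have "(z * (q\<^sup>2) ^ N) powi k = ((q\<^sup>2) ^ nat k) ^ N * z powi k"
        using that by (simp add: power_int_def power_mult_distrib mult_ac flip: power_mult)
      then show ?thesis
        by (simp add: theta_interp_def theta_term_def)
    qed
    show "\<bar>theta_interp 1 (z * (q\<^sup>2) ^ N) k\<bar> \<le> theta_term q z k" for N k
    proof (cases "k < 0")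
      case False
      have "((q\<^sup>2) ^ nat k) ^ N \<le> 1" "0 \<le> ((q\<^sup>2) ^ nat k) ^ N"
        using q by (auto intro!: power_le_one)
      then have "\<bar>((q\<^sup>2) ^ nat k) ^ N * theta_interp 1 z k\<bar> \<le> 1 * \<bar>theta_interp 1 z k\<bar>"
        unfolding abs_mult by (intro mult_right_mono) auto
      then show ?thesis
        using abs_theta_interp_le[OF assms, of 1 k] False nonneg by simp
    qed (use neg theta_term_nonneg[OF q assms] in simp)
    show "(\<lambda>N. theta_interp 1 (z * (q\<^sup>2) ^ N) k) \<longlonglongrightarrow> ?g k" for k
    proof (cases "k \<le> 0")
      case True
      then have "theta_interp 1 (z * (q\<^sup>2) ^ N) k = ?g k" for N
        using neg[of k N] by (cases "k = 0") (simp_all add: theta_interp_def theta_term_def)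
      then show ?thesis
        by simp
    next
      case False
      then have "(q\<^sup>2) ^ nat k < 1"
        using base_square by (intro power_less_one_iff[THEN iffD2]) auto
      then have "(\<lambda>N. ((q\<^sup>2) ^ nat k) ^ N * theta_interp 1 z k) \<longlonglongrightarrow> 0 * theta_interp 1 z k"
        using base_square by (intro tendsto_intros LIMSEQ_power_zero) simp
      then show ?thesis
        using False nonneg[of k] by simp
    qed
  qed
  moreover have "infsum ?g UNIV = qpoch_inf (q\<^sup>2) (q\<^sup>2)"
    using infsum_cong_neutral[of "{0::int}" UNIV ?g ?g] by simp
  ultimately have "(\<lambda>N. qpoch (- z) (q\<^sup>2) N * ?S (z * (q\<^sup>2) ^ N))
      \<longlonglongrightarrow> qpoch_inf (- z) (q\<^sup>2) * qpoch_inf (q\<^sup>2) (q\<^sup>2)"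
    by (intro tendsto_mult qpoch_LIMSEQ base_square) simp
  \<comment> \<open>By \<open>iter\<close> the sequence is constantly the sum sought, which
    therefore equals the limit.\<close>
  then show ?thesis
    using LIMSEQ_unique[OF tendsto_const] unfolding iter[symmetric] by blast
qed

text \<open>Raising \<open>N\<close> from 1 to infinity multiplies Euler's series by the factors of
  \<open>(-Q/z; Q)_inf\<close>, while \<open>(Q^(k+N); Q)_inf -> 1\<close> turns the summands into
  theta terms.\<close>

lemma jacobi_triple_product:
  assumes "z > 0"
  shows "infsum (theta_term q z) UNIV
    = qpoch_inf (- z) (q\<^sup>2) * qpoch_inf (- q\<^sup>2 / z) (q\<^sup>2) * qpoch_inf (q\<^sup>2) (q\<^sup>2)"
proof -
  let ?S = "\<lambda>N. infsum (theta_interp N z) UNIV"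
  have iter: "?S (Suc N) = ?S 1 * qpoch (- q\<^sup>2 / z) (q\<^sup>2) N" for N
    by (induction N) (simp_all add: infsum_theta_interp_Suc[OF assms] qpoch_Suc mult_ac)
  have "?S \<longlonglongrightarrow> infsum (theta_term q z) UNIV"
  proof (rule infsum_dominated_convergence[OF _ abs_theta_interp_le[OF assms]
        theta_term_summable[OF q assms]])
    fix k
    have "(\<lambda>N. qpoch_inf (q\<^sup>2 powi k * (q\<^sup>2) ^ N) (q\<^sup>2) * theta_term q z k) \<longlonglongrightarrow> 1 * theta_term q z k"
      by (intro tendsto_intros qpoch_inf_tendsto_1 base_square)
    then show "(\<lambda>N. theta_interp N z k) \<longlonglongrightarrow> theta_term q z k"
      using q by (simp add: theta_interp_def power_int_add)
  qed
  then have "(\<lambda>N. ?S (Suc N)) \<longlonglongrightarrow> infsum (theta_term q z) UNIV"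
    by (rule LIMSEQ_Suc)
  moreover have "(\<lambda>N. ?S (Suc N)) \<longlonglongrightarrow> ?S 1 * qpoch_inf (- q\<^sup>2 / z) (q\<^sup>2)"
    unfolding iter by (intro tendsto_intros qpoch_LIMSEQ base_square)
  ultimately have "infsum (theta_term q z) UNIV = ?S 1 * qpoch_inf (- q\<^sup>2 / z) (q\<^sup>2)"
    by (rule LIMSEQ_unique)
  then show ?thesis
    unfolding infsum_theta_interp_1[OF assms] by (simp only: mult_ac)
qed

end

subsection \<open>Total mass with a free parameter\<close>

text \<open>The point \<open>e_n\<close> with
  \<open>y n = sqrt (a * q) * (e_n - 1 / e_n)\<close>.\<close>

definition node :: "real \<Rightarrow> real \<Rightarrow> int \<Rightarrow> real" where
  "node q d n = q powi (- 2 * n) / d"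

text \<open>This is the even-indexed theta term \<open>theta_term q (d^2) (2 * n)\<close>.\<close>

definition gauss_weight :: "real \<Rightarrow> real \<Rightarrow> int \<Rightarrow> real" where
  "gauss_weight q d n = d powi (4 * n) * q powi (2 * n * (2 * n - 1))"

text \<open>Separate exponent and parameters: the exponents \<open>j = 0, -2\<close> with \<open>s = t\<close> make up the mass term,
  while the telescoping sequence has \<open>j = 1\<close> and \<open>s \<noteq> t\<close>.\<close>

definition gauss_term :: "real \<Rightarrow> real \<Rightarrow> int \<Rightarrow> real \<Rightarrow> real \<Rightarrow> int \<Rightarrow> real" where
  "gauss_term q d j s t n = gauss_weight q d n * node q d n powi j
     * qpoch_inf (- s * node q d n) q * qpoch_inf (t / node q d n) q"

text \<open>At \<open>t = t2\<close> the unnormalised weight: \<open>1 + 1 / e_n^2\<close> is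
  \<open>1 + d^2 q^(4n)\<close>, and the two base \<open>q\<close> products collect the four of base
  \<open>q^2\<close>.\<close>

definition mass_term :: "real \<Rightarrow> real \<Rightarrow> real \<Rightarrow> int \<Rightarrow> real" where
  "mass_term q d t n = gauss_weight q d n * (1 + 1 / (node q d n)\<^sup>2)
     * qpoch_inf (- t * node q d n) q * qpoch_inf (t / node q d n) q"

context
  fixes q :: real
  assumes q: "0 < q" "q < 1"
begin

section \<open>Nodes and weights under shift and reflection\<close>

lemma q_powi_add: "q powi (m + n) = q powi m * q powi n"
  using q by (simp add: power_int_add)

lemma node_pos: "d > 0 \<Longrightarrow> node q d n > 0"
  using q by (simp add: node_def)

lemma node_powi_minus_2: "node q d n powi (- 2) = d\<^sup>2 * (q powi (2 * n))\<^sup>2"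
proof -
  have "node q d n = inverse (d * q powi (2 * n))"
    by (simp add: node_def power_int_minus divide_inverse)
  then show ?thesis
    by (simp add: power_int_minus power_inverse power_mult_distrib)
qed

lemma gauss_weight_pos: "d > 0 \<Longrightarrow> gauss_weight q d n > 0"
  using q by (simp add: gauss_weight_def)

lemma node_step: "node q d (n + 1) = node q d n / q\<^sup>2"
proof -
  have "- 2 * (n + 1) = - 2 * n + (- 2)"
    by simp
  then have "q powi (- 2 * (n + 1)) = q powi (- 2 * n) * q powi (- 2)"
    by (simp only: q_powi_add)
  then show ?thesis
    unfolding node_def by (simp add: power_int_minus divide_inverse)
qed

lemma gauss_weight_step:
  assumes "d > 0"
  shows "gauss_weight q d (n + 1) = gauss_weight q d n * q\<^sup>2 / node q d n ^ 4"
proof -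
  have "2 * (n + 1) * (2 * (n + 1) - 1) = 2 * n * (2 * n - 1) + (2 * n * 4 + 2)"
    by (simp add: algebra_simps)
  then have "q powi (2 * (n + 1) * (2 * (n + 1) - 1))
      = q powi (2 * n * (2 * n - 1)) * (q powi (2 * n * 4) * q powi 2)"
    by (simp only: q_powi_add)
  moreover have "q powi (2 * n * 4) = (q powi (2 * n)) ^ 4"
    by (simp only: power_int_mult) simp
  moreover have "d powi (4 * (n + 1)) = d powi (4 * n) * d ^ 4"
    using assms by (simp add: distrib_left power_int_add)
  moreover have "1 / node q d n = d * q powi (2 * n)"
    by (simp add: node_def power_int_minus divide_inverse)
  then have "1 / node q d n ^ 4 = d ^ 4 * (q powi (2 * n)) ^ 4"
    by (simp add: power_mult_distrib flip: power_one_over)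
  ultimately show ?thesis
    unfolding gauss_weight_def by (simp add: divide_inverse mult_ac)
qed

text \<open>\<open>n -> -n\<close> together with \<open>d -> 1 / d\<close> inverts the node. With
  parameters \<open>t\<close> and \<open>-t\<close> the two infinite products merely swap, and the
  Gaussian factor accounts for \<open>d^2\<close> and the new exponent. Negative indices thus reduce
  to positive ones.\<close>

lemma gauss_term_uminus:
  assumes "d > 0"
  shows "gauss_term q d j t (- t) (- n) = d\<^sup>2 * gauss_term q (1 / d) (- j - 2) t (- t) n"
proof -
  let ?e = "node q (1 / d) n"
  have e: "?e > 0"
    using assms by (simp add: node_pos)
  have inv: "node q d (- n) = inverse ?e"
    by (simp add: node_def power_int_minus divide_inverse)
  have "2 * (- n) * (2 * (- n) - 1) = 2 * n * (2 * n - 1) + 4 * n"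
    by (simp add: algebra_simps)
  then have "q powi (2 * (- n) * (2 * (- n) - 1)) = q powi (2 * n * (2 * n - 1)) * q powi (4 * n)"
    by (simp only: q_powi_add)
  moreover have "q powi (4 * n) = (q powi (2 * n))\<^sup>2"
  proof -
    have "4 * n = 2 * n * 2"
      by simp
    then show ?thesis
      by (simp only: power_int_mult) simp
  qed
  then have "q powi (4 * n) = d\<^sup>2 * ?e powi (- 2)"
    using assms by (simp only: node_powi_minus_2) (simp add: power_divide)
  moreover have "d powi (4 * (- n)) = (1 / d) powi (4 * n)"
    by (simp add: power_int_minus power_int_inverse divide_inverse)
  ultimately have "gauss_weight q d (- n) = d\<^sup>2 * gauss_weight q (1 / d) n * ?e powi (- 2)"
    unfolding gauss_weight_def by (simp only: mult_ac)
  moreover have "inverse ?e powi j = ?e powi (- j)"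
    by (simp add: power_int_minus power_int_inverse)
  moreover have "?e powi (- j - 2) = ?e powi (- 2) * ?e powi (- j)"
    using e power_int_add[of ?e "- j" "- 2"] by simp
  ultimately show ?thesis
    unfolding gauss_term_def inv by (simp add: divide_inverse)
qed

section \<open>Absolute convergence of the bilateral series\<close>

lemma gauss_term_nonneg:
  assumes "d > 0" "t \<ge> 0"
  shows "gauss_term q d j t (- t) n \<ge> 0"
  using assms node_pos[of d n] gauss_weight_pos[of d n]
    qpoch_inf_ge_1[OF q, of "- t * node q d n"] qpoch_inf_ge_1[OF q, of "- t / node q d n"]
  by (simp add: gauss_term_def)

text \<open>Passing to \<open>n + 1\<close> divides the node \<open>e\<close> by \<open>q^2\<close>:
  one product gains two factors, the other does not increase, and the weight contributes
  \<open>q^2 / e^4\<close>. The ratio is \<open>O(x^2)\<close> in \<open>x = 1 / e\<close>, hence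
  tends to 0 as \<open>n\<close> grows.\<close>

lemma gauss_term_step_le:
  assumes "d > 0" "t \<ge> 0"
  defines "x \<equiv> \<lambda>n. 1 / node q d n"
  shows "gauss_term q d j t (- t) (n + 1)
    \<le> q\<^sup>2 * q powi (- 2 * j) * (x n)\<^sup>2 * (x n + t / q\<^sup>2) * (x n + t / q) * gauss_term q d j t (- t) n"
proof -
  define e where "e = node q d n"
  have e: "e > 0"
    using assms by (simp add: e_def node_pos)
  define A where "A = qpoch_inf (- t * e) q"
  define B where "B = qpoch_inf (- t / e) q"
  define C where "C = qpoch_inf (- t / (e / q\<^sup>2)) q"
  have "A > 0"
    unfolding A_def using assms e by (intro qpoch_inf_pos q) (simp add: less_le_trans[of _ 0])
  have "\<bar>- t / (e / q\<^sup>2)\<bar> \<le> t / e"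
    using assms e q mult_left_mono[of "q\<^sup>2" 1 t] by (simp add: field_simps power_le_one)
  from abs_qpoch_inf_le[OF q this] have "C \<le> B"
    by (simp add: B_def C_def)
  have "qpoch_inf (- t * (e / q\<^sup>2)) q = (1 + t * e / q\<^sup>2) * (1 + t * e / q) * A"
    using q qpoch_inf_rec[OF q, of "- t * e / q\<^sup>2"] qpoch_inf_rec[OF q, of "- t * e / q"]
    by (simp add: A_def power2_eq_square)
  moreover have "q powi (- 2 * j) = inverse (q\<^sup>2 powi j)"
    by (simp add: power_int_minus power_int_mult)
  then have "(e / q\<^sup>2) powi j = e powi j * q powi (- 2 * j)"
    by (simp add: power_int_divide_distrib inverse_eq_divide)
  ultimately have "gauss_term q d j t (- t) (n + 1)
      = (gauss_weight q d n * q\<^sup>2 / e ^ 4 * (e powi j * q powi (- 2 * j))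
          * ((1 + t * e / q\<^sup>2) * (1 + t * e / q) * A)) * C"
    unfolding gauss_term_def node_step gauss_weight_step[OF assms(1)] e_def[symmetric] C_def by simp
  also have "\<dots> \<le> (gauss_weight q d n * q\<^sup>2 / e ^ 4 * (e powi j * q powi (- 2 * j))
          * ((1 + t * e / q\<^sup>2) * (1 + t * e / q) * A)) * B"
    using \<open>C \<le> B\<close> \<open>A > 0\<close> e q assms gauss_weight_pos[of d n]
    by (intro mult_left_mono) (auto intro!: mult_nonneg_nonneg divide_nonneg_nonneg add_nonneg_nonneg less_imp_le)
  also have "\<dots> = q\<^sup>2 * q powi (- 2 * j) * (((1 + t * e / q\<^sup>2) * (1 + t * e / q)) / e ^ 4)
      * (gauss_weight q d n * e powi j * A * B)"
    by (simp add: divide_inverse mult_ac)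
  also have "((1 + t * e / q\<^sup>2) * (1 + t * e / q)) / e ^ 4 = (x n)\<^sup>2 * (x n + t / q\<^sup>2) * (x n + t / q)"
    using e q unfolding x_def e_def[symmetric] by (simp add: field_simps power2_eq_square eval_nat_numeral)
  finally show ?thesis
    unfolding gauss_term_def e_def[symmetric] A_def B_def by (simp add: mult_ac)
qed

lemma gauss_term_summable_abs:
  assumes "d > 0" "t \<ge> 0"
  shows "gauss_term q d j t (- t) summable_on UNIV"
proof (rule summable_on_int)
  \<comment> \<open>Arbitrary \<open>c\<close> and \<open>i\<close>, because the reflection turns
    \<open>d\<close> into \<open>1 / d\<close> and \<open>j\<close> into
    \<open>- j - 2\<close>.\<close>
  have summable: "summable (\<lambda>n. gauss_term q c i t (- t) (int n))" if "c > 0" for c i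
  proof (rule summable_ratio_to_zero)
    let ?x = "\<lambda>n. 1 / node q c (int n)"
    let ?\<rho> = "\<lambda>n. q\<^sup>2 * q powi (- 2 * i) * (?x n)\<^sup>2 * (?x n + t / q\<^sup>2) * (?x n + t / q)"
    show "0 \<le> gauss_term q c i t (- t) (int n)" for n
      using that assms by (intro gauss_term_nonneg)
    show "gauss_term q c i t (- t) (int (Suc n)) \<le> ?\<rho> n * gauss_term q c i t (- t) (int n)" for n
      using gauss_term_step_le[OF that assms(2), of i "int n"] by (simp add: add.commute)
    have "?x n = c * (q\<^sup>2) ^ n" for n
      by (simp add: node_def power_int_minus power_int_mult divide_inverse)
    moreover have "(\<lambda>n. c * (q\<^sup>2) ^ n) \<longlonglongrightarrow> c * 0"
      using q by (intro tendsto_intros LIMSEQ_power_zero) (simp add: power_less_one_iff)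
    ultimately have "?x \<longlonglongrightarrow> 0"
      by simp
    then have "?\<rho> \<longlonglongrightarrow> q\<^sup>2 * q powi (- 2 * i) * 0\<^sup>2 * (0 + t / q\<^sup>2) * (0 + t / q)"
      by (intro tendsto_intros)
    then show "?\<rho> \<longlonglongrightarrow> 0"
      by simp
  qed
  show "summable (\<lambda>n. gauss_term q d j t (- t) (int n))"
    using assms by (intro summable)
  show "summable (\<lambda>n. gauss_term q d j t (- t) (- int n))"
    unfolding gauss_term_uminus[OF assms(1)] using assms by (intro summable_mult summable) simp
qed (use assms in \<open>simp add: gauss_term_nonneg\<close>)

text \<open>With \<open>c\<close> and \<open>-c\<close> both products have nonpositive parameters
  \<open>-c e\<close> and \<open>-c / e\<close>, so one majorant serves all \<open>s\<close> and
  \<open>t\<close> of size at most \<open>c\<close>.\<close>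

lemma abs_gauss_term_le:
  assumes "d > 0" "\<bar>s\<bar> \<le> c" "\<bar>t\<bar> \<le> c"
  shows "\<bar>gauss_term q d j s t n\<bar> \<le> gauss_term q d j c (- c) n"
proof -
  have e: "node q d n > 0" "gauss_weight q d n > 0"
    using assms by (simp_all add: node_pos gauss_weight_pos)
  have "\<bar>qpoch_inf (- s * node q d n) q\<bar> \<le> qpoch_inf (- (c * node q d n)) q"
       "\<bar>qpoch_inf (t / node q d n) q\<bar> \<le> qpoch_inf (- (c / node q d n)) q"
    using e assms by (intro abs_qpoch_inf_le[OF q]; simp add: abs_mult divide_right_mono)+
  then have "\<bar>qpoch_inf (- s * node q d n) q\<bar> * \<bar>qpoch_inf (t / node q d n) q\<bar>
      \<le> qpoch_inf (- (c * node q d n)) q * qpoch_inf (- (c / node q d n)) q"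
    by (intro mult_mono) auto
  then show ?thesis
    using e unfolding gauss_term_def abs_mult
    by (simp add: mult.assoc mult_left_mono)
qed

lemma gauss_term_summable:
  assumes "d > 0"
  shows "gauss_term q d j s t summable_on UNIV"
proof -
  have "(\<lambda>n. norm (gauss_term q d j s t n)) summable_on UNIV"
    by (rule Infinite_Sum.abs_summable_on_comparison_test'
          [OF gauss_term_summable_abs[OF assms, of "max \<bar>s\<bar> \<bar>t\<bar>" j]])
       (use abs_gauss_term_le[OF assms] in auto)
  then show ?thesis
    by (rule abs_summable_summable)
qed

section \<open>Functional equation and value of the total mass\<close>

lemma mass_term_eq: "mass_term q d t n = gauss_term q d 0 t t n + gauss_term q d (- 2) t t n"
  by (simp add: mass_term_def gauss_term_def power_int_minus divide_inverse algebra_simps)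

lemma mass_term_summable:
  assumes "d > 0"
  shows "mass_term q d t summable_on UNIV"
  unfolding mass_term_eq[abs_def] by (intro summable_on_add gauss_term_summable assms)

text \<open>Under \<open>e -> e / q^2\<close> the parameters \<open>t * q\<close> and
  \<open>t / q\<close> in \<open>U\<close> trade places. Hence \<open>U n\<close>,
  \<open>U (n + 1)\<close> and both mass terms are rational multiples of the same product
  \<open>(-t q e, t q / e; q)_inf\<close> times the weight, and the claim becomes the rational
  identity \<open>id\<close>.\<close>

lemma mass_term_telescope:
  fixes t :: real
  assumes "d > 0"
  defines "U \<equiv> \<lambda>n. - t * gauss_term q d 1 (t * q) (t / q) n"
  shows "mass_term q d t n = (1 + t\<^sup>2 / q) * mass_term q d (t * q) n + (U (n + 1) - U n)"
proof -
  define e where "e = node q d n"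
  define K where "K = gauss_weight q d n"
  define X where "X = qpoch_inf (- (t * q) * e) q"
  define Y where "Y = qpoch_inf (t * q / e) q"
  have e: "e > 0"
    using assms by (simp add: e_def node_pos)
  have X1: "qpoch_inf (- t * e) q = (1 + t * e) * X"
    using qpoch_inf_rec[OF q, of "- t * e"] by (simp add: X_def mult_ac)
  have X2: "qpoch_inf (- (t * q) * (e / q\<^sup>2)) q = (1 + t * e / q) * (1 + t * e) * X"
    using qpoch_inf_rec[OF q, of "- t * e / q"] X1 q by (simp add: power2_eq_square)
  have Y1: "qpoch_inf (t / e) q = (1 - t / e) * Y"
    using qpoch_inf_rec[OF q, of "t / e"] by (simp add: Y_def)
  have Y2: "qpoch_inf (t / q / e) q = (1 - t / (q * e)) * (1 - t / e) * Y"
    using qpoch_inf_rec[OF q, of "t / q / e"] q by (simp add: Y1)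
  have Y3: "t / q / (e / q\<^sup>2) = t * q / e"
    using q by (simp add: power2_eq_square)
  have m1: "mass_term q d t n = K * X * Y * ((1 + 1 / e\<^sup>2) * (1 + t * e) * (1 - t / e))"
    unfolding mass_term_def e_def[symmetric] K_def[symmetric] X1 Y1 by (simp add: mult_ac)
  have m2: "mass_term q d (t * q) n = K * X * Y * (1 + 1 / e\<^sup>2)"
    unfolding mass_term_def e_def[symmetric] K_def[symmetric] X_def Y_def by (simp add: mult_ac)
  have u1: "U n = K * X * Y * (- t * e * (1 - t / (q * e)) * (1 - t / e))"
    unfolding U_def gauss_term_def e_def[symmetric] K_def[symmetric] X_def[symmetric] Y2 by (simp add: mult_ac)
  have u2: "U (n + 1) = K * X * Y * (- t / e ^ 3 * (1 + t * e / q) * (1 + t * e))"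
    unfolding U_def gauss_term_def node_step gauss_weight_step[OF assms(1)]
      e_def[symmetric] K_def[symmetric] Y3 X2 Y_def[symmetric]
    using q e by (simp add: eval_nat_numeral)
  have id: "(1 + 1 / e\<^sup>2) * (1 + t * e) * (1 - t / e)
      = (1 + t\<^sup>2 / q) * (1 + 1 / e\<^sup>2) + (- t / e ^ 3 * (1 + t * e / q) * (1 + t * e)
          - (- t * e * (1 - t / (q * e)) * (1 - t / e)))"
    using q e by (simp add: field_simps eval_nat_numeral)
  have factor: "P * (c * B + (C - D)) = c * (P * B) + (P * C - P * D)" for P c B C D :: real
    by (simp add: algebra_simps)
  show ?thesis
    unfolding m1 m2 u1 u2 id by (rule factor)
qed

text \<open>\<open>U\<close> is itself summable over the integers, so its shifted and unshifted sums
  cancel.\<close>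

lemma infsum_mass_term_step:
  assumes "d > 0"
  shows "infsum (mass_term q d t) UNIV = (1 + t\<^sup>2 / q) * infsum (mass_term q d (t * q)) UNIV"
proof -
  define U where "U = (\<lambda>n. - t * gauss_term q d 1 (t * q) (t / q) n)"
  have "U summable_on UNIV"
    unfolding U_def by (intro summable_on_cmult_right gauss_term_summable assms)
  then have U: "(U has_sum infsum U UNIV) UNIV"
    by (rule has_sum_infsum)
  then have U': "((\<lambda>n. U (n + 1)) has_sum infsum U UNIV) UNIV"
    by (subst has_sum_reindex_bij_witness[of _ "\<lambda>n. n - 1" "\<lambda>n. n + 1" UNIV]) auto
  have "((\<lambda>n. (1 + t\<^sup>2 / q) * mass_term q d (t * q) n + (U (n + 1) + - U n)) has_sum
      ((1 + t\<^sup>2 / q) * infsum (mass_term q d (t * q)) UNIV + (infsum U UNIV + - infsum U UNIV))) UNIV"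
    by (intro has_sum_add has_sum_cmult_right has_sum_infsum mass_term_summable assms U' has_sum_uminusI U)
  moreover have "mass_term q d t = (\<lambda>n. (1 + t\<^sup>2 / q) * mass_term q d (t * q) n + (U (n + 1) + - U n))"
    unfolding U_def using mass_term_telescope[OF assms, of t] by (intro ext) simp
  ultimately have "(mass_term q d t has_sum ((1 + t\<^sup>2 / q) * infsum (mass_term q d (t * q)) UNIV)) UNIV"
    by simp
  then show ?thesis
    by (rule infsumI)
qed

text \<open>At \<open>t = 0\<close> the infinite products are 1, and the summands \<open>1\<close>
  and \<open>1 / e_n^2\<close> of the weight yield the even- and odd-indexed terms of the theta
  series.\<close>

lemma infsum_mass_term_0:
  assumes "d > 0"
  shows "infsum (mass_term q d 0) UNIV = infsum (theta_term q (d\<^sup>2)) UNIV"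
proof -
  let ?th = "theta_term q (d\<^sup>2)"
  let ?A = "range (\<lambda>n::int. 2 * n)" and ?B = "range (\<lambda>n::int. 2 * n + 1)"
  have d2: "(d\<^sup>2) powi k = d powi (2 * k)" for k
    by (simp add: power_int_mult)
  have sm: "?th summable_on S" for S
    using theta_term_summable[OF q, of "d\<^sup>2"] assms summable_on_subset by fastforce
  have inj: "inj (\<lambda>n::int. 2 * n)" "inj (\<lambda>n::int. 2 * n + 1)"
    by (auto simp: inj_on_def)
  have even: "gauss_term q d 0 0 0 n = ?th (2 * n)" for n
    by (simp add: gauss_term_def gauss_weight_def theta_term_def d2 q)
  have odd: "gauss_term q d (- 2) 0 0 n = ?th (2 * n + 1)" for n
  proof -
    have "(2 * n + 1) * (2 * n + 1 - 1) = 2 * n * (2 * n - 1) + 2 * n * 2"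
      by (simp add: algebra_simps)
    then have "q powi ((2 * n + 1) * (2 * n + 1 - 1)) = q powi (2 * n * (2 * n - 1)) * q powi (2 * n * 2)"
      by (simp only: q_powi_add)
    moreover have "q powi (2 * n * 2) = (q powi (2 * n))\<^sup>2"
      by (simp only: power_int_mult) simp
    moreover have "d powi (2 * (2 * n + 1)) = d powi (4 * n) * d\<^sup>2"
      using assms by (simp add: distrib_left power_int_add)
    ultimately show ?thesis
      using node_powi_minus_2[of d n] by (simp add: gauss_term_def gauss_weight_def theta_term_def d2 q)
  qed
  have "infsum (mass_term q d 0) UNIV = infsum (\<lambda>n. ?th (2 * n)) UNIV + infsum (\<lambda>n. ?th (2 * n + 1)) UNIV"
    unfolding mass_term_eq[abs_def] even[symmetric] odd[symmetric]
    by (intro infsum_add gauss_term_summable assms)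
  also have "\<dots> = infsum ?th ?A + infsum ?th ?B"
    by (simp add: infsum_reindex[OF inj(1)] infsum_reindex[OF inj(2)] o_def)
  also have "\<dots> = infsum ?th (?A \<union> ?B)"
    by (rule infsum_Un_disjoint[symmetric, OF sm sm]) (auto, presburger)
  also have "?A \<union> ?B = UNIV"
  proof -
    have "x \<in> ?A \<union> ?B" for x
      by (cases "even x") (auto elim: evenE oddE)
    then show ?thesis
      by blast
  qed
  finally show ?thesis .
qed

lemma infsum_mass_term:
  assumes "d > 0"
  shows "infsum (mass_term q d t) UNIV
    = qpoch_inf (- t\<^sup>2 / q) (q\<^sup>2) * infsum (theta_term q (d\<^sup>2)) UNIV"
proof -
  let ?G = "\<lambda>t. infsum (mass_term q d t) UNIV"
  have iter: "?G t = qpoch (- t\<^sup>2 / q) (q\<^sup>2) N * ?G (t * q ^ N)" for N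
  proof (induction N)
    case (Suc N)
    then show ?case
      using infsum_mass_term_step[OF assms, of "t * q ^ N"]
      by (simp add: qpoch_Suc power_mult_distrib mult_ac flip: power_mult)
  qed simp
  have "(\<lambda>N. ?G (t * q ^ N)) \<longlonglongrightarrow> ?G 0"
  proof (rule infsum_dominated_convergence)
    \<comment> \<open>A majorant independent of \<open>N\<close>, available because
      \<open>|t * q^N| <= |t|\<close>.\<close>
    let ?h = "\<lambda>n. gauss_term q d 0 \<bar>t\<bar> (- \<bar>t\<bar>) n + gauss_term q d (- 2) \<bar>t\<bar> (- \<bar>t\<bar>) n"
    show "?h summable_on UNIV"
      by (intro summable_on_add gauss_term_summable assms)
    show "\<bar>mass_term q d (t * q ^ N) n\<bar> \<le> ?h n" for N n
    proof -
      have "\<bar>t * q ^ N\<bar> \<le> \<bar>t\<bar>"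
        using q by (simp add: abs_mult mult_left_le power_le_one)
      then show ?thesis
        unfolding mass_term_eq
        by (intro order_trans[OF abs_triangle_ineq] add_mono abs_gauss_term_le assms)
    qed
    show "(\<lambda>N. mass_term q d (t * q ^ N) n) \<longlonglongrightarrow> mass_term q d 0 n" for n
    proof -
      let ?e = "node q d n"
      have "(\<lambda>N. gauss_weight q d n * (1 + 1 / ?e\<^sup>2) * qpoch_inf (- t * ?e * q ^ N) q
          * qpoch_inf (t / ?e * q ^ N) q) \<longlonglongrightarrow> gauss_weight q d n * (1 + 1 / ?e\<^sup>2) * 1 * 1"
        by (intro tendsto_intros qpoch_inf_tendsto_1[OF q])
      then show ?thesis
        unfolding mass_term_def by (simp add: mult_ac q)
    qed
  qed
  then have "(\<lambda>N. qpoch (- t\<^sup>2 / q) (q\<^sup>2) N * ?G (t * q ^ N))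
      \<longlonglongrightarrow> qpoch_inf (- t\<^sup>2 / q) (q\<^sup>2) * ?G 0"
    by (intro tendsto_mult qpoch_LIMSEQ base_square[OF q])
  then show ?thesis
    using LIMSEQ_unique[OF tendsto_const] infsum_mass_term_0[OF assms] unfolding iter[symmetric] by metis
qed

end

subsection \<open>The dual polynomials\<close>

lemma has_sum_sum:
  fixes f :: "'b \<Rightarrow> 'a \<Rightarrow> real"
  assumes "finite I" "\<And>i. i \<in> I \<Longrightarrow> (f i has_sum s i) A"
  shows "((\<lambda>x. \<Sum>i\<in>I. f i x) has_sum (\<Sum>i\<in>I. s i)) A"
  using assms by (induction I) (auto intro: has_sum_add)

text \<open>At \<open>y = u - a q / u\<close> this is \<open>(u, -a q / u; q)_m\<close>, by
  \<open>qpoch_mu_pair\<close>.\<close>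

definition dual_basis :: "real \<Rightarrow> real \<Rightarrow> nat \<Rightarrow> real \<Rightarrow> real" where
  "dual_basis a q m y = (\<Prod>j<m. 1 - a * q ^ (2 * j + 1) - q ^ j * y)"

text \<open>For \<open>X = q^n\<close> this is \<open>(q^(-n); q)_m\<close> up to sign and a power
  of \<open>q\<close>. Keeping \<open>X\<close> as a variable turns \<open>n + 1\<close> and
  \<open>n - 1\<close> into \<open>q * X\<close> and \<open>X / q\<close>.\<close>

definition node_prod :: "real \<Rightarrow> real \<Rightarrow> nat \<Rightarrow> real" where
  "node_prod q X m = (\<Prod>j<m. q ^ j - X)"

definition dual_coeff :: "real \<Rightarrow> real \<Rightarrow> real \<Rightarrow> nat \<Rightarrow> real" where
  "dual_coeff a q X m = q ^ m * node_prod q X m / (qpoch (- a * q\<^sup>2) (q\<^sup>2) m * qpoch q q m)"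

definition dual_norm :: "real \<Rightarrow> real \<Rightarrow> nat \<Rightarrow> real" where
  "dual_norm a q r = qpoch (q\<^sup>2) (q\<^sup>2) r * q powi (- int r) / qpoch (- a * q\<^sup>2) (q\<^sup>2) r"

section \<open>Coefficients as polynomials in \<open>X = q^n\<close>\<close>

lemma dual_basis_Suc: "dual_basis a q (Suc m) y = dual_basis a q m y * (1 - a * q ^ (2 * m + 1) - q ^ m * y)"
  by (simp add: dual_basis_def)

lemma node_prod_Suc: "node_prod q X (Suc m) = node_prod q X m * (q ^ m - X)"
  by (simp add: node_prod_def)

lemma node_prod_eq_0: "n < m \<Longrightarrow> node_prod q (q ^ n) m = 0"
  by (auto simp: node_prod_def)

lemma node_prod_mult: "node_prod q (q * X) (Suc m) = (1 - q * X) * q ^ m * node_prod q X m"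
proof -
  have "node_prod q (q * X) (Suc m) = (1 - q * X) * (\<Prod>j<m. q * (q ^ j - X))"
    unfolding node_prod_def prod.lessThan_Suc_shift by (simp add: algebra_simps)
  then show ?thesis
    by (simp add: prod.distrib node_prod_def)
qed

text \<open>Distributing the argument over the factors clears the negative powers: each becomes
  \<open>q * (q^j - q^n)\<close>.\<close>

lemma qpoch_power_neg_eq_node_prod:
  assumes "q > 0"
  shows "qpoch (q powi (- int n)) q m * (- (q ^ (n + 1))) ^ m = q ^ m * node_prod q (q ^ n) m"
proof (induction m)
  case (Suc m)
  have "(1 - q powi (- int n) * q ^ m) * (- (q ^ (n + 1))) = q * (q ^ m - q ^ n)"
    using assms by (simp add: power_int_minus field_simps)
  from arg_cong2[OF Suc this, of "(*)"] show ?case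
    unfolding qpoch_Suc node_prod_Suc power_Suc2 by (simp only: mult_ac)
qed (simp add: node_prod_def)

context
  fixes q a :: real
  assumes q: "0 < q" "q < 1" and a: "a > 0"
begin

section \<open>Expansion and three-term recurrence\<close>

lemma qpoch_neg_pos: "qpoch (- a * q\<^sup>2) (q\<^sup>2) m > 0"
  unfolding qpoch_def using q a by (intro prod_pos) (auto intro!: add_pos_nonneg)

lemma qpoch_self_pos: "qpoch q q m > 0"
proof -
  have "q ^ Suc j < 1" for j
    using q power_Suc_less_one by blast
  then show ?thesis
    unfolding qpoch_def by (intro prod_pos) auto
qed

text \<open>Coefficients with \<open>m > n\<close> vanish; the free bound \<open>M\<close> lets
  neighbouring polynomials be summed over one common range.\<close>

lemma dual_ultra_expansion:
  assumes "n \<le> M"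
  shows "poly (dual_ultra a q n) y = (\<Sum>m\<le>M. dual_coeff a q (q ^ n) m * dual_basis a q m y)"
proof -
  have "poly (dual_ultra a q n) y = (\<Sum>m\<le>n. dual_coeff a q (q ^ n) m * dual_basis a q m y)"
    unfolding dual_ultra_explicit[OF q a] dual_ultra_sum_def poly_sum dual_coeff_def
      qpoch_power_neg_eq_node_prod[OF q(1), symmetric] dual_basis_def
    by (intro sum.cong refl) (simp add: poly_prod mult_ac)
  also have "\<dots> = (\<Sum>m\<le>M. dual_coeff a q (q ^ n) m * dual_basis a q m y)"
    using assms by (intro sum.mono_neutral_left) (auto simp: dual_coeff_def node_prod_eq_0)
  finally show ?thesis .
qed

text \<open>Coefficientwise form of the three-term recurrence, with \<open>X\<close> in place of \<open>q ^ n\<close>: since \<open>y\<close> times a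
  basis polynomial involves the next one, the partial sums telescope to a single boundary term.\<close>

lemma dual_coeff_recurrence_partial:
  fixes X y :: real
  defines "X' \<equiv> X / q"
  shows "(\<Sum>m\<le>M. (q * X\<^sup>2 * y * dual_coeff a q X m + (1 + a * q\<^sup>2 * X\<^sup>2) * dual_coeff a q (q * X) m
      - (1 + q) * dual_coeff a q X m + q * (1 - X\<^sup>2) * dual_coeff a q X' m) * dual_basis a q m y)
    = - q * X\<^sup>2 * (node_prod q X M / (qpoch (- a * q\<^sup>2) (q\<^sup>2) M * qpoch q q M)) * dual_basis a q (Suc M) y"
proof (induction M)
  case 0
  show ?case
    by (simp add: dual_coeff_def dual_basis_def node_prod_def) (simp add: algebra_simps power2_eq_square)
next
  case (Suc M)
  define p where "p = q ^ M"
  define E where "E = node_prod q X M"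
  define K where "K = qpoch (- a * q\<^sup>2) (q\<^sup>2) M * qpoch q q M"
  define k where "k = (1 + a * q\<^sup>2 * p\<^sup>2) * (1 - q * p)"
  define B where "B = dual_basis a q (Suc M) y"
  have Kk: "qpoch (- a * q\<^sup>2) (q\<^sup>2) (Suc M) * qpoch q q (Suc M) = K * k"
    by (simp add: K_def k_def p_def qpoch_Suc mult_ac flip: power_mult)
  have Kk0: "K \<noteq> 0" "k \<noteq> 0"
    using qpoch_neg_pos[of M] qpoch_self_pos[of M] qpoch_neg_pos[of "Suc M"] qpoch_self_pos[of "Suc M"] Kk
    by (auto simp: K_def)
  have c1: "dual_coeff a q X (Suc M) = q * p * (E * (p - X)) / (K * k)"
    unfolding dual_coeff_def Kk by (simp add: node_prod_Suc E_def p_def)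
  have c2: "dual_coeff a q (q * X) (Suc M) = q * p * ((1 - q * X) * p * E) / (K * k)"
    unfolding dual_coeff_def Kk node_prod_mult by (simp add: E_def p_def)
  \<comment> \<open>The product at \<open>X / q\<close> lacks the factor \<open>1 - X\<close>. The
    recurrence supplies it through \<open>1 - X^2 = (1 + X) (1 - X)\<close>, so nothing is divided
    by \<open>1 - X\<close>, which is zero for \<open>n = 0\<close>.\<close>
  have "(1 - X) * (q ^ Suc M * node_prod q X' (Suc M)) = (\<Prod>j<Suc M. q * (q ^ j - X')) * (1 - X)"
    unfolding node_prod_def prod.distrib by simp
  also have "(\<Prod>j<Suc M. q * (q ^ j - X')) * (1 - X) = node_prod q X (Suc (Suc M))"
    unfolding node_prod_def X'_def using q
    by (subst (2) prod.lessThan_Suc_shift) (simp add: right_diff_distrib mult_ac)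
  finally have c3: "(1 - X) * dual_coeff a q X' (Suc M) = E * (p - X) * (q * p - X) / (K * k)"
    unfolding dual_coeff_def Kk by (simp add: node_prod_Suc E_def p_def mult_ac)
  have c3': "q * (1 - X\<^sup>2) * dual_coeff a q X' (Suc M) = q * (1 + X) * (E * (p - X) * (q * p - X) / (K * k))"
  proof -
    have "1 - X\<^sup>2 = (1 + X) * (1 - X)"
      by (simp add: power2_eq_square algebra_simps)
    then show ?thesis
      unfolding c3[symmetric] by (simp only: mult_ac)
  qed
  have B: "dual_basis a q (Suc (Suc M)) y = B * (1 - a * q ^ 3 * p\<^sup>2 - q * p * y)"
    unfolding dual_basis_Suc[of a q "Suc M"] B_def[symmetric]
    by (simp add: p_def mult_ac eval_nat_numeral flip: power_add)
  \<comment> \<open>With the common factor \<open>B\<close> removed and everything over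
    \<open>K * k\<close>, the induction step is a polynomial identity.\<close>
  have key: "- q * X\<^sup>2 * (E / K) + (q * X\<^sup>2 * y * (q * p * (E * (p - X)) / (K * k))
      + (1 + a * q\<^sup>2 * X\<^sup>2) * (q * p * ((1 - q * X) * p * E) / (K * k))
      - (1 + q) * (q * p * (E * (p - X)) / (K * k)) + q * (1 + X) * (E * (p - X) * (q * p - X) / (K * k)))
    = - q * X\<^sup>2 * (E * (p - X) / (K * k)) * (1 - a * q ^ 3 * p\<^sup>2 - q * p * y)"
  proof -
    have "E / K = E * k / (K * k)"
      using Kk0 by simp
    moreover have "- q * X\<^sup>2 * (E * k) + (q * X\<^sup>2 * y * (q * p * (E * (p - X)))
      + (1 + a * q\<^sup>2 * X\<^sup>2) * (q * p * ((1 - q * X) * p * E))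
      - (1 + q) * (q * p * (E * (p - X))) + q * (1 + X) * (E * (p - X) * (q * p - X)))
      = - q * X\<^sup>2 * (E * (p - X)) * (1 - a * q ^ 3 * p\<^sup>2 - q * p * y)"
      unfolding k_def by algebra
    ultimately show ?thesis
      by (simp only: times_divide_eq_right times_divide_eq_left add_divide_distrib[symmetric]
          diff_divide_distrib[symmetric])
  qed
  show ?case
    unfolding sum.atMost_Suc Suc.IH B Kk node_prod_Suc[of q X M] c1 c2 c3'
      B_def[symmetric] E_def[symmetric] p_def[symmetric] K_def[symmetric]
    unfolding mult.assoc[symmetric, of _ B] distrib_right[symmetric, of _ B]
    using arg_cong[OF key, of "\<lambda>v. v * B"] by (simp only: mult_ac)
qed

text \<open>At \<open>n = 0\<close> the truncated index \<open>n - 1 = 0\<close> is harmless since its factor \<open>1 - (q ^ n)\<^sup>2\<close> vanishes.\<close>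

lemma dual_ultra_recurrence:
  fixes y :: real
  defines "D \<equiv> \<lambda>n. poly (dual_ultra a q n) y"
  shows "q * (q ^ n)\<^sup>2 * (y * D n)
    = - (1 + a * q\<^sup>2 * (q ^ n)\<^sup>2) * D (Suc n) + (1 + q) * D n - q * (1 - (q ^ n)\<^sup>2) * D (n - 1)"
proof -
  let ?X = "q ^ n"
  let ?S = "\<lambda>X. \<Sum>m\<le>Suc n. dual_coeff a q X m * dual_basis a q m y"
  have D: "D n = ?S ?X" "D (Suc n) = ?S (q * ?X)"
    using dual_ultra_expansion[of n "Suc n" y] dual_ultra_expansion[of "Suc n" "Suc n" y]
    by (simp_all add: D_def)
  have D': "q * (1 - ?X\<^sup>2) * D (n - 1) = q * (1 - ?X\<^sup>2) * ?S (?X / q)"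
  proof (cases n)
    case (Suc k)
    then have "?X / q = q ^ k"
      using q by simp
    then show ?thesis
      using dual_ultra_expansion[of k "Suc n" y] Suc by (simp add: D_def)
  qed simp
  \<comment> \<open>At \<open>M = n + 1\<close> the boundary term contains
    \<open>node_prod q (q^n) (n + 1) = 0\<close>.\<close>
  have "q * ?X\<^sup>2 * y * ?S ?X + (1 + a * q\<^sup>2 * ?X\<^sup>2) * ?S (q * ?X) - (1 + q) * ?S ?X
      + q * (1 - ?X\<^sup>2) * ?S (?X / q) = 0"
    using dual_coeff_recurrence_partial[of ?X y "Suc n"] node_prod_eq_0[of n "Suc n" q]
    unfolding sum_distrib_left sum.distrib[symmetric] sum_subtractf[symmetric]
    by (simp only: distrib_right left_diff_distrib mult.assoc)
  then show ?thesis
    unfolding D' unfolding D by (simp add: algebra_simps)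
qed

text \<open>The sum telescopes because \<open>node_prod q X (Suc M)\<close> is \<open>1 - X\<close>
  times the product on the right. At \<open>X = q^r\<close> and \<open>M = r >= 1\<close> that
  product contains \<open>q^r - X = 0\<close>, which makes \<open>D_r\<close> orthogonal to
  constants.\<close>

lemma alternating_node_prod_sum:
  "(\<Sum>m\<le>M. (- 1) ^ m * node_prod q X m / qpoch q q m) = (- 1) ^ M * (\<Prod>j<M. q ^ Suc j - X) / qpoch q q M"
proof (induction M)
  case (Suc M)
  have shift: "node_prod q X (Suc M) = (1 - X) * (\<Prod>j<M. q ^ Suc j - X)"
    unfolding node_prod_def prod.lessThan_Suc_shift by simp
  have "1 - q * q ^ M \<noteq> 0" "qpoch q q M \<noteq> 0"
    using qpoch_self_pos[of M] qpoch_self_pos[of "Suc M"] by (auto simp: qpoch_Suc)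
  then show ?case
    unfolding sum.atMost_Suc Suc.IH shift qpoch_Suc prod.lessThan_Suc
    by (simp add: field_simps)
qed (simp add: node_prod_def)

text \<open>The ratio of consecutive norms matches the outer coefficients of the recurrence; this
  compatibility lets the recurrence propagate orthogonality.\<close>

lemma dual_norm_Suc:
  "(1 + a * q\<^sup>2 * (q ^ s)\<^sup>2) * dual_norm a q (Suc s) = (1 - (q ^ Suc s)\<^sup>2) * dual_norm a q s / q"
proof -
  have eq: "qpoch (- a * q\<^sup>2) (q\<^sup>2) (Suc s) = qpoch (- a * q\<^sup>2) (q\<^sup>2) s * (1 + a * q\<^sup>2 * (q ^ s)\<^sup>2)"
    "qpoch (q\<^sup>2) (q\<^sup>2) (Suc s) = qpoch (q\<^sup>2) (q\<^sup>2) s * (1 - (q ^ Suc s)\<^sup>2)"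
    by (simp_all add: qpoch_Suc power_mult_distrib mult_ac flip: power_mult)
  have "- int (Suc s) = - int s + - 1"
    by simp
  then have "q powi (- int (Suc s)) = q powi (- int s) * q powi (- 1)"
    by (simp only: q_powi_add[OF q])
  then have "q powi (- int (Suc s)) = q powi (- int s) / q"
    by (simp add: power_int_minus divide_inverse)
  moreover have "1 + a * q\<^sup>2 * (q ^ s)\<^sup>2 \<noteq> 0"
    using q a by (smt (verit) mult_nonneg_nonneg zero_le_power2)
  ultimately show ?thesis
    unfolding dual_norm_def eq by (simp add: mult_ac)
qed

text \<open>Strong induction on \<open>s\<close>. The recurrence at \<open>s - 1\<close> expresses
  \<open>D_s\<close> through polynomials of lower index and \<open>y D_(s-1)\<close>; in the product
  with \<open>D_r\<close> the factor \<open>y\<close> is moved to \<open>D_r\<close> and removed by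
  the recurrence at \<open>r\<close>. All second indices are then below \<open>s\<close>.\<close>

lemma dual_ultra_orthogonal_of_moments:
  fixes w y :: "'i \<Rightarrow> real"
  assumes moments: "\<And>m. ((\<lambda>i. w i * dual_basis a q m (y i)) has_sum
      ((- 1) ^ m / q ^ m * qpoch (- a * q\<^sup>2) (q\<^sup>2) m)) UNIV"
  shows "((\<lambda>i. w i * poly (dual_ultra a q r) (y i) * poly (dual_ultra a q s) (y i)) has_sum
      (if r = s then dual_norm a q r else 0)) UNIV"
proof (induction s arbitrary: r rule: less_induct)
  case (less s)
  define D where "D = (\<lambda>n i. poly (dual_ultra a q n) (y i))"
  define \<delta> where "\<delta> = (\<lambda>r s. if r = s then dual_norm a q r else 0)"
  have D0: "D 0 i = 1" for i
    using dual_ultra_expansion[of 0 0 "y i"]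
    by (simp add: D_def dual_coeff_def dual_basis_def node_prod_def)
  show ?case
  proof (cases s)
    case 0
    have "((\<lambda>i. \<Sum>m\<le>r. dual_coeff a q (q ^ r) m * (w i * dual_basis a q m (y i))) has_sum
      (\<Sum>m\<le>r. dual_coeff a q (q ^ r) m * ((- 1) ^ m / q ^ m * qpoch (- a * q\<^sup>2) (q\<^sup>2) m))) UNIV"
      by (intro has_sum_sum has_sum_cmult_right moments) simp
    moreover have "(\<Sum>m\<le>r. dual_coeff a q (q ^ r) m * (w i * dual_basis a q m (y i))) = w i * D r i" for i
      by (simp add: D_def dual_ultra_expansion[of r r] sum_distrib_left mult_ac)
    moreover have "(\<Sum>m\<le>r. dual_coeff a q (q ^ r) m * ((- 1) ^ m / q ^ m * qpoch (- a * q\<^sup>2) (q\<^sup>2) m))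
        = (\<Sum>m\<le>r. (- 1) ^ m * node_prod q (q ^ r) m / qpoch q q m)"
    proof (intro sum.cong refl)
      fix m
      show "dual_coeff a q (q ^ r) m * ((- 1) ^ m / q ^ m * qpoch (- a * q\<^sup>2) (q\<^sup>2) m)
        = (- 1) ^ m * node_prod q (q ^ r) m / qpoch q q m"
        using q qpoch_neg_pos[of m] unfolding dual_coeff_def by (simp add: field_simps)
    qed
    moreover have "(\<Sum>m\<le>r. (- 1) ^ m * node_prod q (q ^ r) m / qpoch q q m) = \<delta> r 0"
      unfolding alternating_node_prod_sum
      by (cases r) (simp_all add: \<delta>_def dual_norm_def)
    ultimately show ?thesis
      using D0 unfolding 0 by (simp only: D_def \<delta>_def mult_1_right)
  next
    case (Suc s')
    let ?X = "\<lambda>n. (q ^ n)\<^sup>2"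
    have IH: "((\<lambda>i. w i * D r i * D n i) has_sum \<delta> r n) UNIV" if "n \<le> s'" for r n
      using less.IH[of n r] that Suc by (simp add: D_def \<delta>_def)
    let ?c = "1 + a * q\<^sup>2 * ?X s'" and ?f = "?X s' / ?X r"
    have "?c > 0"
      using q a by (intro add_pos_nonneg) auto
    have rec: "q * ?X n * (y i * D n i) = - (1 + a * q\<^sup>2 * ?X n) * D (Suc n) i + (1 + q) * D n i
        - q * (1 - ?X n) * D (n - 1) i" for n i
      using dual_ultra_recurrence[of n "y i"] by (simp add: D_def)
    \<comment> \<open>The outcome of this substitution as a linear form, applied both to the
      products and to their sums. \<open>?f\<close> compensates for the different factors of
      \<open>y\<close> in the recurrences at \<open>s'\<close> and \<open>r\<close>.\<close>
    let ?comb = "\<lambda>F :: nat \<Rightarrow> nat \<Rightarrow> real. ((1 + q) * F r s' + (- q * (1 - ?X s')) * F r (s' - 1)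
      + (?f * (1 + a * q\<^sup>2 * ?X r)) * F (Suc r) s' + (- ?f * (1 + q)) * F r s'
      + (?f * (q * (1 - ?X r))) * F (r - 1) s') * (1 / ?c)"
    have comb_sum: "((\<lambda>i. ?comb (\<lambda>m n. w i * D m i * D n i)) has_sum ?comb \<delta>) UNIV"
      by (intro has_sum_cmult_left has_sum_add has_sum_cmult_right IH) auto
    have combine: "(b * (v * R * S) + (- q * k) * (v * R * P) + (f * A) * (v * R1 * S)
        + (- f * b) * (v * R * S) + (f * (q * l)) * (v * R0 * S)) * (1 / c) = v * R * T"
      if "c * T * R = R * (b * S - q * k * P) - f * (S * (- A * R1 + b * R - q * l * R0))" "c > 0"
      for b v R S k P f A R1 l R0 c T :: real
    proof -
      have "v * R * T = v * (c * T * R) * (1 / c)"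
        using that(2) by simp
      also have "v * (c * T * R) = b * (v * R * S) + (- q * k) * (v * R * P) + (f * A) * (v * R1 * S)
          + (- f * b) * (v * R * S) + (f * (q * l)) * (v * R0 * S)"
        unfolding that(1) by (simp add: algebra_simps)
      finally show ?thesis ..
    qed
    have comb_eq: "?comb (\<lambda>m n. w i * D m i * D n i) = w i * D r i * D s i" for i
    proof -
      have "?X r \<noteq> 0"
        using q by simp
      have divide: "u = v - Y / X * z" if "X * u = X * v - Y * z" "X \<noteq> 0" for u v z X Y :: real
        using that by (simp add: field_simps)
      have "?c * D s i = (1 + q) * D s' i - q * (1 - ?X s') * D (s' - 1) i - q * ?X s' * (y i * D s' i)"
        using rec[of s' i] unfolding Suc by linarith
      then have "?X r * (?c * D s i * D r i)
          = ?X r * (D r i * ((1 + q) * D s' i - q * (1 - ?X s') * D (s' - 1) i))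
            - ?X s' * (D s' i * (q * ?X r * (y i * D r i)))"
        by (simp only:) (simp only: left_diff_distrib right_diff_distrib mult_ac)
      then have "?c * D s i * D r i = D r i * ((1 + q) * D s' i - q * (1 - ?X s') * D (s' - 1) i)
            - ?f * (D s' i * (q * ?X r * (y i * D r i)))"
        using \<open>?X r \<noteq> 0\<close> by (rule divide)
      then show ?thesis
        unfolding rec[of r i] by (rule combine[OF _ \<open>?c > 0\<close>])
    qed
    have comb_val: "?comb \<delta> = \<delta> r s"
    proof -
      have X0: "?X n \<noteq> 0" "?X (Suc n) = q\<^sup>2 * ?X n" for n
        using q by (simp_all add: power_mult_distrib)
      \<comment> \<open>Contributions need \<open>|r - s'| <= 1\<close>: \<open>r = s' + 1\<close>
        produces the norm, \<open>r = s'\<close> cancels as \<open>?f = 1\<close>, and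
        \<open>s' = r + 1\<close> cancels by \<open>dual_norm_Suc\<close>.\<close>
      consider "r = Suc s'" | "r = s'" | "s' = Suc r" | "r \<noteq> Suc s'" "r \<noteq> s'" "s' \<noteq> Suc r"
        by blast
      then show ?thesis
      proof cases
        case 1
        moreover have "Suc s' \<noteq> s' - 1"
          by simp
        ultimately have "?comb \<delta> = (1 - ?X r) * dual_norm a q s' / q * (1 / ?c)"
          using X0 q by (simp add: \<delta>_def power2_eq_square)
        then show ?thesis
          unfolding 1 dual_norm_Suc[symmetric] using \<open>?c > 0\<close> Suc by (simp add: \<delta>_def)
      next
        case 2
        \<comment> \<open>For \<open>s' = 0\<close> the truncated \<open>s' - 1\<close> and
          \<open>r - 1\<close> coincide with \<open>s'\<close>, but their coefficients contain
          \<open>1 - ?X 0 = 0\<close>.\<close>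
        then show ?thesis
          using q Suc by (cases s') (simp_all add: \<delta>_def, simp_all add: algebra_simps)
      next
        case 3
        moreover have "r - 1 \<noteq> Suc r"
          by simp
        ultimately have "?comb \<delta> = (- q * (1 - ?X s') * dual_norm a q r
            + ?f * ((1 + a * q\<^sup>2 * ?X r) * dual_norm a q (Suc r))) * (1 / ?c)"
          by (simp add: \<delta>_def)
        also have "?f = q\<^sup>2"
          using X0 3 by simp
        finally show ?thesis
          unfolding dual_norm_Suc using 3 Suc q by (simp add: \<delta>_def power2_eq_square)
      next
        case 4
        then have "r \<noteq> s' - 1" "r - 1 \<noteq> s'"
          by auto
        with 4 show ?thesis
          using Suc by (simp add: \<delta>_def)
      qed
    qed
    have "((\<lambda>i. w i * D r i * D s i) has_sum \<delta> r s) UNIV"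
      using comb_sum unfolding comb_eq comb_val .
    then show ?thesis
      by (simp only: D_def \<delta>_def)
  qed
qed

end

subsection \<open>The orthogonality relation\<close>

text \<open>At the node the factor of index \<open>m\<close> splits as
  \<open>-(p^2 / t^2) (1 + (t/p) e) (1 - (t/p) / e)\<close> with \<open>p = q^(m+1)\<close>. The
  last two are the factors gained by the infinite products when the parameter changes from
  \<open>t / q^m\<close> to \<open>t / q^(m+1)\<close>.\<close>

lemma mass_term_mult_dual_basis:
  fixes q d t :: real
  assumes "0 < q" "q < 1" "d > 0" "t > 0"
  shows "mass_term q d t n * dual_basis (q / t\<^sup>2) q m (q / t * (node q d n - 1 / node q d n))
    = (- 1) ^ m * q ^ m\<^sup>2 * (q / t\<^sup>2) ^ m * mass_term q d (t / q ^ m) n"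
proof (induction m)
  case 0
  show ?case
    by (simp add: dual_basis_def)
next
  case (Suc m)
  note q = assms(1,2)
  define e where "e = node q d n"
  define p where "p = q ^ Suc m"
  have pos: "e > 0" "p > 0"
    using assms by (simp_all add: e_def p_def node_pos)
  have tp: "t / p * q = t / q ^ m"
    using q by (simp add: p_def)
  have "qpoch_inf (- (t / p) * e) q = (1 + t / p * e) * qpoch_inf (- (t / q ^ m) * e) q"
       "qpoch_inf (t / p / e) q = (1 - t / p / e) * qpoch_inf (t / q ^ m / e) q"
    using qpoch_inf_rec[OF q, of "- (t / p) * e"] qpoch_inf_rec[OF q, of "t / p / e"]
    unfolding tp[symmetric] by (simp_all add: mult_ac)
  then have step: "mass_term q d (t / p) n = (1 + t / p * e) * (1 - t / p / e) * mass_term q d (t / q ^ m) n"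
    unfolding mass_term_def e_def[symmetric] by (simp only: mult_ac)
  have "q ^ (2 * m + 1) * q = p\<^sup>2" "q ^ m * q = p"
    by (simp_all add: p_def power2_eq_square power_mult power_mult_distrib)
  then have "1 - q / t\<^sup>2 * q ^ (2 * m + 1) - q ^ m * (q / t * (e - 1 / e)) = 1 - p\<^sup>2 / t\<^sup>2 - p / t * (e - 1 / e)"
    by (simp add: mult_ac)
  also have "\<dots> = - (p\<^sup>2 / t\<^sup>2) * ((1 + t / p * e) * (1 - t / p / e))"
    using pos assms by (simp add: field_simps power2_eq_square)
  finally have factor: "1 - q / t\<^sup>2 * q ^ (2 * m + 1) - q ^ m * (q / t * (e - 1 / e))
      = - (p\<^sup>2 / t\<^sup>2) * ((1 + t / p * e) * (1 - t / p / e))" .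
  have "(Suc m)\<^sup>2 = m\<^sup>2 + (2 * m + 1)"
    by (simp add: power2_eq_square)
  then have "(- 1) ^ Suc m * q ^ (Suc m)\<^sup>2 * (q / t\<^sup>2) ^ Suc m
      = (- 1) ^ m * q ^ m\<^sup>2 * (q / t\<^sup>2) ^ m * - (p\<^sup>2 / t\<^sup>2)"
    unfolding \<open>q ^ (2 * m + 1) * q = p\<^sup>2\<close>[symmetric] by (simp add: power_add mult_ac)
  then show ?case
    unfolding p_def[symmetric] step dual_basis_Suc mult.assoc[symmetric] Suc.IH e_def[symmetric] factor
    using Suc.IH[folded e_def] factor by (simp only: mult_ac)
qed

text \<open>Compares the total masses at \<open>t / q^m\<close> and \<open>t\<close> for
  \<open>t^2 = q / a\<close>. Each step gains a factor \<open>1 + 1 / (a q^(2m+2))\<close>, which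
  \<open>a q^(2m+1)\<close> turns into \<open>(1 + a q^(2m+2)) / q\<close>.\<close>

lemma mass_ratio:
  fixes q a :: real
  assumes "0 < q" "q < 1" "a > 0"
  shows "q ^ m\<^sup>2 * a ^ m * qpoch_inf (- 1 / (a * q ^ (2 * m))) (q\<^sup>2)
    = 1 / q ^ m * qpoch (- a * q\<^sup>2) (q\<^sup>2) m * qpoch_inf (- 1 / a) (q\<^sup>2)"
proof (induction m)
  case (Suc m)
  have q2: "0 < q\<^sup>2" "q\<^sup>2 < 1"
    using base_square assms by auto
  have "- 1 / (a * q ^ (2 * Suc m)) * q\<^sup>2 = - 1 / (a * q ^ (2 * m))"
    using assms by (simp add: field_simps power2_eq_square)
  then have rec: "qpoch_inf (- 1 / (a * q ^ (2 * Suc m))) (q\<^sup>2)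
      = (1 + 1 / (a * q ^ (2 * Suc m))) * qpoch_inf (- 1 / (a * q ^ (2 * m))) (q\<^sup>2)"
    using qpoch_inf_rec[OF q2, of "- 1 / (a * q ^ (2 * Suc m))"] by simp
  have "(Suc m)\<^sup>2 = m\<^sup>2 + (2 * m + 1)"
    by (simp add: power2_eq_square)
  then have pow: "q ^ (Suc m)\<^sup>2 * a ^ Suc m = q ^ m\<^sup>2 * a ^ m * (a * q ^ (2 * m + 1))"
    by (simp add: power_add mult_ac)
  have factor: "a * q ^ (2 * m + 1) * (1 + 1 / (a * q ^ (2 * Suc m))) = 1 / q * (1 + a * q\<^sup>2 * (q\<^sup>2) ^ m)"
    using assms by (simp add: field_simps power2_eq_square power_mult power_mult_distrib)
  have "q ^ (Suc m)\<^sup>2 * a ^ Suc m * qpoch_inf (- 1 / (a * q ^ (2 * Suc m))) (q\<^sup>2)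
      = (a * q ^ (2 * m + 1) * (1 + 1 / (a * q ^ (2 * Suc m))))
        * (q ^ m\<^sup>2 * a ^ m * qpoch_inf (- 1 / (a * q ^ (2 * m))) (q\<^sup>2))"
    unfolding pow rec by (simp only: mult_ac)
  also have "\<dots> = 1 / q * (1 + a * q\<^sup>2 * (q\<^sup>2) ^ m)
      * (1 / q ^ m * qpoch (- a * q\<^sup>2) (q\<^sup>2) m * qpoch_inf (- 1 / a) (q\<^sup>2))"
    unfolding factor Suc.IH ..
  finally show ?case
    unfolding qpoch_Suc by (simp add: mult_ac)
qed simp

theorem mainTheorem4:
  fixes q a d t1 t2 :: real and y :: "int \<Rightarrow> real" and r s :: nat
  assumes "0 < q" "q < 1" and "a > 0" and "q \<le> d" "d < 1"
    and "t1 = sqrt (q ^ 3 / a)" and "t2 = sqrt (q / a)"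
    and "\<And>n. y n = sqrt (a * q) * (inverse d * q powi (- 2 * n) - d * q powi (2 * n))"
  shows "((\<lambda>n::int.
       qpochs_inf [- t1 * q powi (- 2 * n) / d, t1 * q powi (2 * n) * d,
                   - t2 * q powi (- 2 * n) / d, t2 * q powi (2 * n) * d] (q\<^sup>2)
         / qpoch_inf (- t1 * t2 / q\<^sup>2) (q\<^sup>2)
       * (d powi (4 * n) * q powi (2 * n * (2 * n - 1)) * (1 + d\<^sup>2 * q powi (4 * n))
         / (qpoch_inf (- d\<^sup>2) (q\<^sup>2) * qpoch_inf (- q\<^sup>2 / d\<^sup>2) (q\<^sup>2) * qpoch_inf (q\<^sup>2) (q\<^sup>2)))
       * poly (dual_ultra a q r) (y n) * poly (dual_ultra a q s) (y n))
     has_sum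
       (qpoch (q\<^sup>2) (q\<^sup>2) r * q powi (- int r) / qpoch (- a * q\<^sup>2) (q\<^sup>2) r
         * (if r = s then 1 else 0))) UNIV"
proof -
  note q = \<open>0 < q\<close> \<open>q < 1\<close>
  note q2 = base_square[OF q]
  have d: "d > 0"
    using assms by simp
  have t2: "t2 > 0"
    using assms by simp
  have t2_sq: "t2\<^sup>2 = q / a"
    using assms by simp
  then have a_eq: "a = q / t2\<^sup>2"
    using assms by simp
  have "sqrt (q ^ 3 / a) = sqrt (q\<^sup>2 * (q / a))"
    by (simp add: eval_nat_numeral)
  then have t1: "t1 = q * t2"
    using assms by (simp only: real_sqrt_mult) simp
  have t12: "- t1 * t2 / q\<^sup>2 = - 1 / a"
    using t1 t2_sq q by (simp add: power2_eq_square)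
  have "sqrt (a * q) * t2 = sqrt (q\<^sup>2)"
    using assms by (simp add: power2_eq_square flip: real_sqrt_mult)
  then have sqrt_aq: "sqrt (a * q) = q / t2"
    using t2 q by (simp add: field_simps)
  have inv_node: "1 / node q d n = d * q powi (2 * n)" for n
    by (simp add: node_def power_int_minus divide_inverse)
  have y: "y n = q / t2 * (node q d n - 1 / node q d n)" for n
    unfolding assms(8) sqrt_aq inv_node by (simp add: node_def divide_inverse mult_ac)
  \<comment> \<open>\<open>Z\<close> is the total mass at \<open>t = t2\<close>, as
    \<open>t2^2 / q = 1 / a\<close>; the normalised weight \<open>w\<close> then has sum 1.\<close>
  define Z where "Z = qpoch_inf (- 1 / a) (q\<^sup>2)
    * (qpoch_inf (- d\<^sup>2) (q\<^sup>2) * qpoch_inf (- q\<^sup>2 / d\<^sup>2) (q\<^sup>2) * qpoch_inf (q\<^sup>2) (q\<^sup>2))"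
  have jtp: "infsum (theta_term q (d\<^sup>2)) UNIV
      = qpoch_inf (- d\<^sup>2) (q\<^sup>2) * qpoch_inf (- q\<^sup>2 / d\<^sup>2) (q\<^sup>2) * qpoch_inf (q\<^sup>2) (q\<^sup>2)"
    using d by (intro jacobi_triple_product q) simp
  have "Z > 0"
    unfolding Z_def using q2 d assms
    by (intro mult_pos_pos qpoch_inf_pos) (auto intro: le_less_trans[of _ 0])
  define w where "w = (\<lambda>n. mass_term q d t2 n / Z)"
  have weight: "qpochs_inf [- t1 * q powi (- 2 * n) / d, t1 * q powi (2 * n) * d,
                   - t2 * q powi (- 2 * n) / d, t2 * q powi (2 * n) * d] (q\<^sup>2)
         / qpoch_inf (- t1 * t2 / q\<^sup>2) (q\<^sup>2)
       * (d powi (4 * n) * q powi (2 * n * (2 * n - 1)) * (1 + d\<^sup>2 * q powi (4 * n))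
         / (qpoch_inf (- d\<^sup>2) (q\<^sup>2) * qpoch_inf (- q\<^sup>2 / d\<^sup>2) (q\<^sup>2) * qpoch_inf (q\<^sup>2) (q\<^sup>2)))
     = w n" for n
  proof -
    let ?e = "node q d n"
    \<comment> \<open>As \<open>t1 = q * t2\<close>, the four arguments form two pairs
      \<open>x * q\<close>, \<open>x\<close>, which \<open>qpoch_inf_base_square\<close> merges into
      base \<open>q\<close>.\<close>
    have args: "- t1 * q powi (- 2 * n) / d = - t2 * ?e * q" "t1 * q powi (2 * n) * d = t2 / ?e * q"
      "- t2 * q powi (- 2 * n) / d = - t2 * ?e" "t2 * q powi (2 * n) * d = t2 / ?e"
    proof -
      have "t2 / ?e = t2 * (d * q powi (2 * n))"
        unfolding inv_node[symmetric] by simp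
      then show "t1 * q powi (2 * n) * d = t2 / ?e * q" "t2 * q powi (2 * n) * d = t2 / ?e"
        unfolding t1 by simp_all
    qed (simp_all add: t1 node_def divide_inverse mult_ac)
    have "4 * n = 2 * n * 2"
      by simp
    then have "q powi (4 * n) = (q powi (2 * n))\<^sup>2"
      by (simp only: power_int_mult) simp
    then have "d\<^sup>2 * q powi (4 * n) = 1 / ?e\<^sup>2"
      using inv_node[of n] by (metis power_mult_distrib power_one_over)
    then show ?thesis
      unfolding args t12 w_def Z_def mass_term_def gauss_weight_def
        qpoch_inf_base_square[OF q, of "- t2 * ?e"] qpoch_inf_base_square[OF q, of "t2 / ?e"]
      by (simp add: qpochs_inf_def divide_inverse mult_ac)
  qed
  have moments: "((\<lambda>n. w n * dual_basis a q m (y n)) has_sum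
      ((- 1) ^ m / q ^ m * qpoch (- a * q\<^sup>2) (q\<^sup>2) m)) UNIV" for m
  proof -
    \<comment> \<open>The factor from \<open>mass_term_mult_dual_basis\<close>, where
      \<open>q / t2^2 = a\<close>, over the normalisation \<open>Z\<close>.\<close>
    let ?c = "(- 1) ^ m * q ^ m\<^sup>2 * a ^ m / Z"
    have "((\<lambda>n. ?c * mass_term q d (t2 / q ^ m) n) has_sum
        ?c * infsum (mass_term q d (t2 / q ^ m)) UNIV) UNIV"
      by (intro has_sum_cmult_right has_sum_infsum mass_term_summable q d)
    moreover have "w n * dual_basis a q m (y n) = ?c * mass_term q d (t2 / q ^ m) n" for n
      using mass_term_mult_dual_basis[OF q d t2, of n m, folded a_eq] unfolding w_def y by simp
    moreover have "?c * infsum (mass_term q d (t2 / q ^ m)) UNIV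
        = (- 1) ^ m / q ^ m * qpoch (- a * q\<^sup>2) (q\<^sup>2) m"
    proof -
      have "- (t2 / q ^ m)\<^sup>2 / q = - 1 / (a * q ^ (2 * m))"
        using q by (simp add: power_divide t2_sq power_mult power_even_eq mult_ac)
      then have "?c * infsum (mass_term q d (t2 / q ^ m)) UNIV
        = (- 1) ^ m * (q ^ m\<^sup>2 * a ^ m * qpoch_inf (- 1 / (a * q ^ (2 * m))) (q\<^sup>2))
          * infsum (theta_term q (d\<^sup>2)) UNIV / Z"
        unfolding infsum_mass_term[OF q d] by (simp add: mult_ac)
      also have "\<dots> = (- 1) ^ m / q ^ m * qpoch (- a * q\<^sup>2) (q\<^sup>2) m * Z / Z"
        unfolding mass_ratio[OF q assms(3)] jtp Z_def by (simp add: divide_inverse mult_ac)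
      finally show ?thesis
        using \<open>Z > 0\<close> by simp
    qed
    ultimately show ?thesis
      by simp
  qed
  have "dual_norm a q r * (if r = s then 1 else 0) = (if r = s then dual_norm a q r else 0)"
    by simp
  then show ?thesis
    using dual_ultra_orthogonal_of_moments[OF q assms(3) moments, of r s]
    unfolding weight dual_norm_def by (simp only:)
qed

end
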